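(* Let $G=(V,E)$ be a locally finite, connected graph that has a closed, transitive, amenable and nonunimodular subgroup of automorphisms. Let $u_n$ be the $n$-step return probability of simple random walk on $G$, let $\rho$ be the spectral radius of $G$, and let $a_n=u_n/\rho^n$. Then there is a constant $c>0$ such that $a_n\le c\,n^{-3/2}$ for all $n\ge 1$.
   Context: $G=(V,E)$ is an infinite graph. $\mathrm{Aut}(G)$ is the group of automorphisms of $G$, with the topology generated by its action on $G$ (pointwise convergence); it is a locally compact group, and "closed" refers to this topology. A subgroup $\Gamma\subset\mathrm{Aut}(G)$ is transitive if for all $x,y\in V$ there is $\gamma\in\Gamma$ with $\gamma(x)=y$. $\Gamma$ is unimodular if its left Haar measure is also a right Haar measure, and nonunimodular otherwise. $\Gamma$ is amenable if there is an invariant mean on $L^\infty(\Gamma)$ (left Haar measure), i.e. a linear functional $\mu$ mapping the constant function $\mathbf 1$ to $1$ and nonnegative functions to nonnegative numbers, with $\mu(L_\gamma f)=\mu(f)$ for all $\gamma\in\Gamma$, where $L_\gamma f(x)=f(\gamma x)$. For simple random walk $(X_n)_{n\ge0}$ on $G$, $u_n=\mathbb P_x[X_n=x]$, which does not depend on $x\in V$ when $G$ is transitive, and $\rho=\limsup_{n\to\infty}u_n^{1/n}$. *)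

theory Defs
  imports "HOL-Probability.Probability" "HOL-Algebra.Coset"
begin

section \<open>Graphs and their automorphism groups\<close>

text \<open>
  A graph is given by its adjacency relation \<open>E\<close>; its vertex set is the whole type
  \<open>'v\<close>. The graph is simple when \<open>E\<close> is symmetric and irreflexive.
\<close>

definition simple_graph :: "'v rel \<Rightarrow> bool" where
  "simple_graph E \<longleftrightarrow> sym E \<and> irrefl E"

definition locally_finite_graph :: "'v rel \<Rightarrow> bool" where
  "locally_finite_graph E \<longleftrightarrow> (\<forall>x. finite (E `` {x}))"

definition connected_graph :: "'v rel \<Rightarrow> bool" where
  "connected_graph E \<longleftrightarrow> (\<forall>x y. (x, y) \<in> E\<^sup>*)"

definition automorphisms :: "'v rel \<Rightarrow> ('v \<Rightarrow> 'v) set" where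
  "automorphisms E = {g. bij g \<and> (\<forall>x y. (g x, g y) \<in> E \<longleftrightarrow> (x, y) \<in> E)}"

definition Aut :: "'v rel \<Rightarrow> ('v \<Rightarrow> 'v) monoid" where
  "Aut E = \<lparr>carrier = automorphisms E, mult = (\<circ>), one = id\<rparr>"

definition pointwise_topology :: "('v \<Rightarrow> 'v) topology" where
  "pointwise_topology = product_topology (\<lambda>_. discrete_topology UNIV) UNIV"

definition Aut_topology :: "'v rel \<Rightarrow> ('v \<Rightarrow> 'v) topology" where
  "Aut_topology E = subtopology pointwise_topology (automorphisms E)"

definition transitive_action :: "('v \<Rightarrow> 'v) set \<Rightarrow> bool" where
  "transitive_action \<Gamma> \<longleftrightarrow> (\<forall>x y. \<exists>\<gamma>\<in>\<Gamma>. \<gamma> x = y)"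


section \<open>Haar measures, unimodularity and amenability\<close>

text \<open>
  The notions below are meant for a locally compact Hausdorff group, presented as a group
  \<open>G\<close> together with a topology \<open>T\<close> on its carrier.
\<close>

definition Borel_sigma :: "'a topology \<Rightarrow> 'a measure" where
  "Borel_sigma T = sigma (topspace T) {U. openin T U}"

definition Radon_measure :: "'a topology \<Rightarrow> 'a measure \<Rightarrow> bool" where
  "Radon_measure T M \<longleftrightarrow>
     sets M = sets (Borel_sigma T) \<and>
     (\<forall>K. compactin T K \<longrightarrow> emeasure M K < \<infinity>) \<and>
     (\<forall>A\<in>sets M. emeasure M A = (INF U\<in>{U. openin T U \<and> A \<subseteq> U}. emeasure M U)) \<and>
     (\<forall>U. openin T U \<longrightarrow> emeasure M U = (SUP K\<in>{K. compactin T K \<and> K \<subseteq> U}. emeasure M K))"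

definition left_Haar_measure ::
    "('a, 'b) monoid_scheme \<Rightarrow> 'a topology \<Rightarrow> 'a measure \<Rightarrow> bool" where
  "left_Haar_measure G T M \<longleftrightarrow>
     Radon_measure T M \<and> emeasure M (space M) \<noteq> 0 \<and>
     (\<forall>g\<in>carrier G. \<forall>A\<in>sets M. emeasure M (g <#\<^bsub>G\<^esub> A) = emeasure M A)"

definition right_Haar_measure ::
    "('a, 'b) monoid_scheme \<Rightarrow> 'a topology \<Rightarrow> 'a measure \<Rightarrow> bool" where
  "right_Haar_measure G T M \<longleftrightarrow>
     Radon_measure T M \<and> emeasure M (space M) \<noteq> 0 \<and>
     (\<forall>g\<in>carrier G. \<forall>A\<in>sets M. emeasure M (A #>\<^bsub>G\<^esub> g) = emeasure M A)"

text \<open>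
  A left Haar measure exists and is unique up to a positive factor, so neither unimodularity
  nor amenability depends on whether it is quantified universally or existentially.
\<close>

definition unimodular :: "('a, 'b) monoid_scheme \<Rightarrow> 'a topology \<Rightarrow> bool" where
  "unimodular G T \<longleftrightarrow> (\<forall>M. left_Haar_measure G T M \<longrightarrow> right_Haar_measure G T M)"

text \<open>
  The elements of \<open>L\<^sup>\<infinity>\<close> are represented by functions rather than by classes modulo almost
  everywhere equality. An invariant mean nevertheless lives on the classes: if \<open>f = g\<close> almost
  everywhere, then linearity and positivity applied to \<open>f - g\<close> and \<open>g - f\<close> give
  \<open>\<mu> f = \<mu> g\<close>.
\<close>

definition L_infinity :: "'a measure \<Rightarrow> ('a \<Rightarrow> real) set" where
  "L_infinity M = {f \<in> borel_measurable M. \<exists>C. AE x in M. \<bar>f x\<bar> \<le> C}"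

definition invariant_mean ::
    "('a, 'b) monoid_scheme \<Rightarrow> 'a measure \<Rightarrow> (('a \<Rightarrow> real) \<Rightarrow> real) \<Rightarrow> bool" where
  "invariant_mean G M \<mu> \<longleftrightarrow>
     (\<forall>f\<in>L_infinity M. \<forall>g\<in>L_infinity M. \<mu> (\<lambda>x. f x + g x) = \<mu> f + \<mu> g) \<and>
     (\<forall>c. \<forall>f\<in>L_infinity M. \<mu> (\<lambda>x. c * f x) = c * \<mu> f) \<and>
     \<mu> (\<lambda>_. 1) = 1 \<and>
     (\<forall>f\<in>L_infinity M. (AE x in M. 0 \<le> f x) \<longrightarrow> 0 \<le> \<mu> f) \<and>
     (\<forall>\<gamma>\<in>carrier G. \<forall>f\<in>L_infinity M. \<mu> (\<lambda>x. f (\<gamma> \<otimes>\<^bsub>G\<^esub> x)) = \<mu> f)"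

definition amenable :: "('a, 'b) monoid_scheme \<Rightarrow> 'a topology \<Rightarrow> bool" where
  "amenable G T \<longleftrightarrow> (\<exists>M. left_Haar_measure G T M \<and> (\<exists>\<mu>. invariant_mean G M \<mu>))"


section \<open>Simple random walk\<close>

text \<open>The law of \<open>X\<^sub>n\<close> for the walk started at \<open>x\<close>, provided all degrees are finite and positive.\<close>

primrec srw :: "'v rel \<Rightarrow> 'v \<Rightarrow> nat \<Rightarrow> 'v pmf" where
  "srw E x 0 = return_pmf x"
| "srw E x (Suc n) = bind_pmf (srw E x n) (\<lambda>y. pmf_of_set (E `` {y}))"

definition return_prob :: "'v rel \<Rightarrow> 'v \<Rightarrow> nat \<Rightarrow> real" where
  "return_prob E x n = pmf (srw E x n) x"

text \<open>The \<open>limsup\<close> is taken in the extended reals; it lies in the interval from 0 to 1.\<close>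

definition spectral_radius :: "'v rel \<Rightarrow> 'v \<Rightarrow> real" where
  "spectral_radius E x = real_of_ereal (limsup (\<lambda>n. ereal (root n (return_prob E x n))))"

end

theory Submission
  imports Defs
begin

text \<open>
  The proof studies the simple random walk through the modular function of \<open>\<Gamma>\<close>. For vertices \<open>x\<close> and \<open>y\<close> let
  \<open>h x y\<close> be the logarithm of the ratio of the sizes of the orbits \<open>\<Gamma>\<^sub>y x\<close> and \<open>\<Gamma>\<^sub>x y\<close> of their stabilisers. This is an invariant
  cocycle, which is not identically \<open>0\<close> since \<open>\<Gamma>\<close> is nonunimodular (\<open>unimodular_if_h_zero\<close>), and it governs the
  mass-transport principle: for every diagonally invariant \<open>f\<close> the sum of \<open>f u y\<close> over the \<open>y\<close> in a ball around \<open>u\<close> equals the sum of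
  \<open>f y u * exp (h u y)\<close> (\<open>mass_transport\<close>). Let \<open>deg\<close> be the degree, let \<open>lam\<close> be the average of \<open>exp (h x z / 2)\<close> over the neighbours
  \<open>z\<close> of \<open>x\<close>, and let \<open>q x y = exp (h x y / 2) / (deg * lam)\<close> on edges. Then \<open>q\<close> is a stochastic kernel. By mass
  transport the heights \<open>h x X\<^sub>n\<close> of the walk \<open>X\<close> with kernel \<open>q\<close> started at \<open>x\<close> perform a symmetric nondegenerate random walk on the line, and
  since \<open>h x x = 0\<close> the return probabilities satisfy \<open>u\<^sub>n = lam ^ n * q\<^sub>n(x, x)\<close>. Two facts finish the proof.

  First, \<open>q\<^sub>n(x, x)\<close> is at most a constant times \<open>n powr (- 3 / 2)\<close> (\<open>weighted_loops_bound\<close>). That the height returns to \<open>0\<close> only gives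
  \<open>n powr (- 1 / 2)\<close>. But a loop may be viewed from its first vertex of maximal height, and changing the base point from
  \<open>x\<close> to that vertex costs, by mass transport, a factor that is exponentially small in the difference of the heights.
  Hence loops at \<open>x\<close> are controlled by pairs of paths that stay below their base point and
  join it to a vertex at essentially bounded depth. For a symmetric walk on the line,
  staying on a half-line for \<open>n\<close> steps and ending at bounded height has probability of order \<open>n powr (- 3 / 2)\<close>
  (\<open>killed_window_bound\<close>), and the convolution of this sequence with itself is of the same order.

  Second, \<open>lam\<close> is at most the spectral radius (\<open>lam_le_spectral_radius\<close>), and this is where amenability enters. Otherwise a
  Green function at a parameter \<open>t\<close> between the two would converge. The mean over \<open>x\<close> of the
  logarithmic increments in \<open>y\<close> of \<open>G y x\<close> is an invariant antisymmetric function of edges. Its drift under \<open>q\<close> is \<open>0\<close> by mass transport, but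
  superharmonicity of the Green function forces the drift to be at most \<open>ln (t / lam) < 0\<close>.
\<close>

section \<open>Symmetric random walks confined to a half-line\<close>

lemma cos_ge_one_minus_half_square: "1 - x\<^sup>2 / 2 \<le> cos (x::real)"
proof -
  have "\<bar>sin (x/2)\<bar> \<le> \<bar>x/2\<bar>" by (rule abs_sin_x_le_abs_x)
  then have "(sin (x/2))\<^sup>2 \<le> (x/2)\<^sup>2" by (simp only: abs_le_square_iff)
  moreover have "cos x = 1 - 2 * (sin (x/2))\<^sup>2"
    using cos_double_sin[of "x/2"] by simp
  ultimately show ?thesis by (simp add: power2_eq_square)
qed

lemma cos_le_one_minus_quarter_square:
  assumes "\<bar>x::real\<bar> \<le> 1" shows "cos x \<le> 1 - x\<^sup>2 / 4"
proof -
  have *: "cos y \<le> 1 - y\<^sup>2 / 4" if y: "0 < y" "y \<le> 1" for y :: real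
  proof -
    obtain z where z: "0 < z" "z < y/2" "sin (y/2) - sin 0 = (y/2 - 0) * cos z"
      using MVT2[of 0 "y/2" sin cos] y by (auto intro!: DERIV_sin)
    have "z\<^sup>2 \<le> 1/4" using z y by (intro order_trans[OF power_mono[of z "1/2" 2]]) (auto simp: power2_eq_square)
    then have "cos z \<ge> 7/8" using cos_ge_one_minus_half_square[of z] by linarith
    then have "(y/2) * (7/8) \<le> (y/2) * cos z" using y by (intro mult_left_mono) auto
    also have "\<dots> = sin (y/2)" using z by simp
    finally have "sin (y/2) \<ge> (y/2) * (7/8)" .
    then have "(sin (y/2))\<^sup>2 \<ge> ((y/2) * (7/8))\<^sup>2" using y by (intro power_mono) auto
    moreover have "((y/2) * (7/8))\<^sup>2 \<ge> y\<^sup>2 / 8" by (simp add: power2_eq_square)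
    moreover have "cos y = 1 - 2 * (sin (y/2))\<^sup>2" using cos_double_sin[of "y/2"] by simp
    ultimately show ?thesis by linarith
  qed
  consider "x = 0" | "x > 0" | "x < 0" by linarith
  then show ?thesis using *[of x] *[of "-x"] assms by cases auto
qed

text \<open>
  The bound does not depend on \<open>j\<close>: the sum is part of two geometric series, one on each side of \<open>j\<close>.
\<close>

lemma sum_power_abs_diff_le:
  fixes r :: real
  assumes "0 < r" "r < 1"
  shows "(\<Sum>k<N. r ^ nat \<bar>int j - int k\<bar>) \<le> 2 / (1 - r)"
proof -
  have geo: "(\<Sum>i\<in>A. r ^ i) \<le> 1 / (1 - r)" if "finite A" for A
    using assms sum_le_suminf[of "(^) r" A] that suminf_geometric[of r] by (auto intro: summable_geometric)
  have "(\<Sum>k<N. r ^ nat \<bar>int j - int k\<bar>) =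
      (\<Sum>k\<in>{..<N} \<inter> {..j}. r ^ nat \<bar>int j - int k\<bar>) + (\<Sum>k\<in>{..<N} - {..j}. r ^ nat \<bar>int j - int k\<bar>)"
    by (rule sum.Int_Diff) simp
  also have "(\<Sum>k\<in>{..<N} \<inter> {..j}. r ^ nat \<bar>int j - int k\<bar>) = (\<Sum>i\<in>(\<lambda>k. j - k) ` ({..<N} \<inter> {..j}). r ^ i)"
    by (subst sum.reindex) (auto simp: inj_on_def intro!: sum.cong arg_cong[of _ _ "(^) r"])
  also have "(\<Sum>k\<in>{..<N} - {..j}. r ^ nat \<bar>int j - int k\<bar>) = (\<Sum>i\<in>(\<lambda>k. k - j) ` ({..<N} - {..j}). r ^ i)"
    by (subst sum.reindex) (auto simp: inj_on_def intro!: sum.cong arg_cong[of _ _ "(^) r"])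
  also have "(\<Sum>i\<in>(\<lambda>k. j - k) ` ({..<N} \<inter> {..j}). r ^ i) + (\<Sum>i\<in>(\<lambda>k. k - j) ` ({..<N} - {..j}). r ^ i)
      \<le> 1 / (1 - r) + 1 / (1 - r)"
    by (intro add_mono geo) auto
  finally show ?thesis by simp
qed

definition window :: "real \<Rightarrow> real \<Rightarrow> real \<Rightarrow> real" where
  "window a b x = of_bool (a \<le> x \<and> x \<le> b)"

definition on_nonpos :: "(real \<Rightarrow> real) \<Rightarrow> real \<Rightarrow> real" where
  "on_nonpos f x = (if x \<le> 0 then f x else 0)"

text \<open>
  The walk on the line that moves by \<open>s i\<close> with probability \<open>p i\<close>. It is represented by the operator
  \<open>avg\<close>, which maps \<open>f\<close> to the expectation of \<open>f\<close> after one step, so that \<open>(avg ^^ n) f x\<close> is the expectation of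
  \<open>f\<close> after \<open>n\<close> steps from \<open>x\<close>. The number \<open>L\<close> bounds the steps and is also the length of all windows below.
\<close>

locale symmetric_walk =
  fixes S :: "'a set" and p s :: "'a \<Rightarrow> real" and L :: real
  assumes finite_steps: "finite S"
    and p_nonneg: "i \<in> S \<Longrightarrow> 0 \<le> p i"
    and p_sum: "sum p S = 1"
    and symmetric_law: "(\<Sum>i\<in>S. p i * f (s i)) = (\<Sum>i\<in>S. p i * f (- s i :: real))"
    and step_le: "i \<in> S \<Longrightarrow> \<bar>s i\<bar> \<le> L"
    and nondegenerate: "\<exists>i\<in>S. 0 < p i \<and> s i \<noteq> 0"
begin

definition avg :: "(real \<Rightarrow> real) \<Rightarrow> real \<Rightarrow> real" where
  "avg f x = (\<Sum>i\<in>S. p i * f (x + s i))"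

text \<open>
  The expectation of \<open>f\<close> after \<open>n\<close> steps on the event that the walk is never positive at the times
  \<open>0, ..., n\<close>.
\<close>

fun killed :: "nat \<Rightarrow> (real \<Rightarrow> real) \<Rightarrow> real \<Rightarrow> real" where
  "killed 0 f = on_nonpos f"
| "killed (Suc n) f = on_nonpos (avg (killed n f))"

lemma L_pos: "L > 0"
  using nondegenerate step_le by force

lemma avg_mono: "(\<And>i. i \<in> S \<Longrightarrow> f (x + s i) \<le> g (x + s i)) \<Longrightarrow> avg f x \<le> avg g x"
  unfolding avg_def by (intro sum_mono mult_left_mono p_nonneg) auto

lemma avg_const: "avg (\<lambda>_. c) x = c"
  unfolding avg_def by (simp add: sum_distrib_right[symmetric] p_sum)

lemma avg_cmult: "avg (\<lambda>y. c * f y) x = c * avg f x"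
  unfolding avg_def by (simp add: sum_distrib_left mult_ac)

lemma avg_add: "avg (\<lambda>y. f y + g y) x = avg f x + avg g x"
  unfolding avg_def by (simp add: sum.distrib algebra_simps)

lemma avg_sum: "avg (\<lambda>y. \<Sum>i\<in>I. f i y) x = (\<Sum>i\<in>I. avg (f i) x)"
  unfolding avg_def by (simp add: sum_distrib_left sum.swap[of _ S])

lemma avg_pow_mono: "(\<And>y. f y \<le> g y) \<Longrightarrow> (avg ^^ n) f x \<le> (avg ^^ n) g x"
  by (induction n arbitrary: x) (auto intro: avg_mono)

lemma avg_pow_const: "(avg ^^ n) (\<lambda>_. c) x = c"
proof (induction n arbitrary: x)
  case (Suc n)
  then have "(avg ^^ n) (\<lambda>_. c) = (\<lambda>_. c)" by auto
  then show ?case by (simp add: avg_const)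
qed simp

lemma avg_pow_cmult: "(avg ^^ n) (\<lambda>y. c * f y) x = c * (avg ^^ n) f x"
proof (induction n arbitrary: x)
  case (Suc n)
  then have "(avg ^^ n) (\<lambda>y. c * f y) = (\<lambda>x. c * (avg ^^ n) f x)" by auto
  then show ?case by (simp add: avg_cmult)
qed simp

lemma avg_pow_sum: "(avg ^^ n) (\<lambda>y. \<Sum>i\<in>I. f i y) x = (\<Sum>i\<in>I. (avg ^^ n) (f i) x)"
proof (induction n arbitrary: x)
  case (Suc n)
  then have "(avg ^^ n) (\<lambda>y. \<Sum>i\<in>I. f i y) = (\<lambda>x. \<Sum>i\<in>I. (avg ^^ n) (f i) x)" by auto
  then show ?case by (simp add: avg_sum)
qed simp

lemma avg_pow_shift: "(avg ^^ n) (\<lambda>y. f (y + c)) x = (avg ^^ n) f (x + c)"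
proof (induction n arbitrary: x)
  case (Suc n)
  then have "(avg ^^ n) (\<lambda>y. f (y + c)) = (\<lambda>x. (avg ^^ n) f (x + c))" by auto
  then show ?case by (simp add: avg_def[of "(avg ^^ n) f"] avg_def[of "\<lambda>x. (avg ^^ n) f (x + c)"] algebra_simps)
qed simp

lemma avg_pow_reflect: "(avg ^^ n) (\<lambda>y. f (c - y)) x = (avg ^^ n) f (c - x)"
proof (induction n arbitrary: x)
  case (Suc n)
  then have "(avg ^^ n) (\<lambda>y. f (c - y)) = (\<lambda>x. (avg ^^ n) f (c - x))" by auto
  then show ?case using symmetric_law[of "\<lambda>t. (avg ^^ n) f (c - x - t)"]
    by (simp add: avg_def[of "(avg ^^ n) f"] avg_def[of "\<lambda>x. (avg ^^ n) f (c - x)"] algebra_simps)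
qed simp

text \<open>
  The characteristic function of a step, which is real because the step law is symmetric.
\<close>

definition \<phi> :: "real \<Rightarrow> real" where "\<phi> t = (\<Sum>i\<in>S. p i * cos (t * s i))"

lemma avg_pow_cos: "(avg ^^ n) (\<lambda>x. cos (t * x)) x = \<phi> t ^ n * cos (t * x)"
proof (induction n arbitrary: x)
  case (Suc n)
  then have "(avg ^^ n) (\<lambda>x. cos (t * x)) = (\<lambda>x. \<phi> t ^ n * cos (t * x))" by auto
  moreover have "avg (\<lambda>x. cos (t * x)) x = \<phi> t * cos (t * x)"
  proof -
    have "(\<Sum>i\<in>S. p i * sin (t * s i)) = 0"
      using symmetric_law[of "\<lambda>u. sin (t * u)"] by (simp add: sum_negf)
    moreover have "avg (\<lambda>x. cos (t * x)) x = cos (t * x) * \<phi> t - sin (t * x) * (\<Sum>i\<in>S. p i * sin (t * s i))"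
      unfolding avg_def \<phi>_def
      by (simp add: distrib_left cos_add sum_distrib_left sum_subtractf[symmetric] algebra_simps)
    ultimately show ?thesis by simp
  qed
  ultimately show ?case by (simp add: avg_cmult)
qed simp

definition step_variance :: real where "step_variance = (\<Sum>i\<in>S. p i * (s i)\<^sup>2)"

lemma step_variance_pos: "step_variance > 0"
  unfolding step_variance_def
proof -
  obtain i where i: "i \<in> S" "0 < p i" "s i \<noteq> 0" using nondegenerate by auto
  show "(\<Sum>i\<in>S. p i * (s i)\<^sup>2) > 0"
    by (rule sum_pos2[OF finite_steps i(1)]) (use i p_nonneg in auto)
qed

text \<open>
  For such \<open>t\<close> every \<open>t * s i\<close> lies between \<open>- 1\<close> and \<open>1\<close>, where the cosine is nonnegative and
  at most \<open>1 - (t * s i)\<^sup>2 / 4\<close>.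
\<close>

lemma \<phi>_bound:
  assumes "\<bar>t\<bar> * L \<le> 1" shows "\<bar>\<phi> t\<bar> \<le> exp (- (step_variance / 4) * t\<^sup>2)"
proof -
  have ts: "\<bar>t * s i\<bar> \<le> 1" if "i \<in> S" for i
    using mult_left_mono[OF step_le[OF that], of "\<bar>t\<bar>"] assms by (simp add: abs_mult)
  have "\<phi> t \<ge> 0"
    unfolding \<phi>_def
  proof (intro sum_nonneg mult_nonneg_nonneg p_nonneg)
    fix i assume "i \<in> S"
    then have "(t * s i)\<^sup>2 \<le> 1" using ts abs_square_le_1 by blast
    then show "0 \<le> cos (t * s i)" using cos_ge_one_minus_half_square[of "t * s i"] by linarith
  qed
  moreover have "\<phi> t \<le> (\<Sum>i\<in>S. p i * (1 - (t * s i)\<^sup>2 / 4))"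
    unfolding \<phi>_def by (intro sum_mono mult_left_mono p_nonneg cos_le_one_minus_quarter_square ts)
  moreover have "(\<Sum>i\<in>S. p i * (1 - (t * s i)\<^sup>2 / 4)) = 1 - (step_variance / 4) * t\<^sup>2"
    unfolding step_variance_def by (simp add: algebra_simps sum_subtractf p_sum sum_distrib_left sum_divide_distrib power_mult_distrib)
  moreover have "1 - (step_variance / 4) * t\<^sup>2 \<le> exp (- (step_variance / 4) * t\<^sup>2)"
    using exp_ge_add_one_self[of "- (step_variance / 4) * t\<^sup>2"] by simp
  ultimately show ?thesis by linarith
qed

text \<open>
  A concentration inequality. The indicator of a window is dominated by a multiple of a Fejer kernel, a nonnegative
  trigonometric polynomial, and \<open>avg\<close> multiplies each of its frequencies \<open>t\<close> by \<open>\<phi> t\<close>. With about \<open>sqrt n\<close>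
  frequencies that are multiples of about \<open>1 / sqrt n\<close>, the Gaussian bound on \<open>\<phi>\<close> leaves a bounded sum for each
  row of the kernel, while the kernel is of order \<open>n\<close> on the window.
\<close>

lemma window_bound:
  obtains C where "C \<ge> 1" "\<And>n z x. (avg ^^ n) (window z (z + L)) x \<le> C / sqrt (real n + 1)"
proof -
  define a where "a = step_variance / (16 * L\<^sup>2)"
  have a: "a > 0" unfolding a_def using step_variance_pos L_pos by simp
  define r where "r = exp (-a)"
  have r: "0 < r" "r < 1" unfolding r_def using a by auto
  define D where "D = 8 / (1 - r)"
  have D: "D \<ge> 8" unfolding D_def using r by (simp add: field_simps)
  have main: "(avg ^^ n) (window z (z + L)) x \<le> D / sqrt (real n)" if n: "n \<ge> 1" for n z x
  proof -
    \<comment> \<open>The kernel has the frequencies \<open>(j - k) * \<eta>\<close> for \<open>j, k < N\<close>, all of absolute value at most \<open>1 / L\<close>.\<close>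
    define N where "N = nat \<lceil>sqrt (real n)\<rceil>"
    have s1: "sqrt (real n) \<ge> 1" using n by simp
    have N: "real N \<ge> sqrt (real n)" "real N \<le> 2 * sqrt (real n)"
      unfolding N_def using s1 by linarith+
    have Npos: "N > 0" using N s1 by linarith
    define \<eta> where "\<eta> = 1 / (L * real N)"
    define F where "F = (\<lambda>y. \<Sum>j<N. \<Sum>k<N. cos ((real j - real k) * \<eta> * y))"
    \<comment> \<open>As a sum of two squares the kernel is nonnegative.\<close>
    have F_sq: "F y = (\<Sum>j<N. cos (real j * \<eta> * y))\<^sup>2 + (\<Sum>j<N. sin (real j * \<eta> * y))\<^sup>2" for y
      unfolding F_def power2_eq_square sum_product sum.distrib[symmetric]
      by (simp add: cos_diff left_diff_distrib algebra_simps)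
    have F_low: "window z (z + L) y \<le> 4 / (real N)\<^sup>2 * F (y - z)" for y
    proof (cases "z \<le> y \<and> y \<le> z + L")
      case True
      have "cos (real j * \<eta> * (y - z)) \<ge> 1/2" if "j < N" for j
      proof -
        have "0 \<le> real j * \<eta> * (y - z)" unfolding \<eta>_def using True L_pos by simp
        moreover have "real j * \<eta> * (y - z) \<le> real N * \<eta> * L"
          unfolding \<eta>_def using True L_pos that by (intro mult_mono) auto
        moreover have "real N * \<eta> * L = 1" unfolding \<eta>_def using Npos L_pos by simp
        ultimately have "(real j * \<eta> * (y - z))\<^sup>2 \<le> 1" by (intro power_le_one) auto
        then show ?thesis using cos_ge_one_minus_half_square[of "real j * \<eta> * (y - z)"] by linarith
      qed
      then have "(\<Sum>j<N. 1/2) \<le> (\<Sum>j<N. cos (real j * \<eta> * (y - z)))" by (intro sum_mono) auto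
      then have "(real N / 2)\<^sup>2 \<le> (\<Sum>j<N. cos (real j * \<eta> * (y - z)))\<^sup>2" by (intro power_mono) auto
      then have "(real N)\<^sup>2 / 4 \<le> F (y - z)"
        unfolding F_sq by (simp add: power_divide add_increasing2)
      then show ?thesis using True Npos by (simp add: window_def field_simps)
    next
      case False
      then show ?thesis unfolding window_def F_sq by auto
    qed
    \<comment> \<open>One row of the kernel after \<open>n\<close> steps. Squares of integers are at least their absolute values, so a geometric series bounds the Gaussian sum.\<close>
    have inner: "(\<Sum>k<N. \<phi> ((real j - real k) * \<eta>) ^ n * cos ((real j - real k) * \<eta> * (x - z))) \<le> 2 / (1 - r)"
      if j: "j < N" for j
    proof -
      have "\<phi> ((real j - real k) * \<eta>) ^ n * cos ((real j - real k) * \<eta> * (x - z)) \<le> r ^ nat \<bar>int j - int k\<bar>"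
        if k: "k < N" for k
      proof -
        define m where "m = \<bar>real j - real k\<bar>"
        have m: "m = real (nat \<bar>int j - int k\<bar>)" unfolding m_def by simp
        have mN: "m \<le> real N" unfolding m_def using j k by linarith
        have "\<bar>(real j - real k) * \<eta>\<bar> * L = m / real N"
          unfolding m_def \<eta>_def using L_pos Npos by (simp add: abs_mult)
        then have "\<bar>\<phi> ((real j - real k) * \<eta>)\<bar> \<le> exp (- (step_variance / 4) * ((real j - real k) * \<eta>)\<^sup>2)"
          using mN Npos by (intro \<phi>_bound) (simp add: divide_le_eq)
        then have "\<bar>\<phi> ((real j - real k) * \<eta>)\<bar> ^ n \<le> exp (- (step_variance / 4) * ((real j - real k) * \<eta>)\<^sup>2) ^ n"
          by (intro power_mono) auto
        also have "\<dots> = exp (- (real n * (step_variance / 4) * ((real j - real k) * \<eta>)\<^sup>2))"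
          by (simp add: exp_of_nat_mult[symmetric])
        also have "\<dots> \<le> exp (- (a * m))"
        proof -
          have "(real N)\<^sup>2 \<le> (2 * sqrt (real n))\<^sup>2" using N by (intro power_mono) auto
          then have "(real N)\<^sup>2 \<le> 4 * real n" by (simp add: power_mult_distrib)
          then have "1/4 \<le> real n / (real N)\<^sup>2" using Npos by (simp add: field_simps)
          then have "(step_variance / (4 * L\<^sup>2)) * m\<^sup>2 * (1/4) \<le> (step_variance / (4 * L\<^sup>2)) * m\<^sup>2 * (real n / (real N)\<^sup>2)"
            using step_variance_pos by (intro mult_left_mono) auto
          moreover have "real n * (step_variance / 4) * ((real j - real k) * \<eta>)\<^sup>2 = (step_variance / (4 * L\<^sup>2)) * m\<^sup>2 * (real n / (real N)\<^sup>2)"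
            unfolding m_def \<eta>_def using L_pos Npos by (simp add: field_simps power_mult_distrib)
          moreover have "a * m \<le> a * m\<^sup>2"
          proof -
            have "m = 0 \<or> m \<ge> 1" unfolding m by (cases "nat \<bar>int j - int k\<bar>") auto
            then have "m \<le> m\<^sup>2" unfolding power2_eq_square by (auto intro: mult_right_mono[of 1 m m, simplified])
            then show ?thesis using a by (intro mult_left_mono) auto
          qed
          moreover have "a * m\<^sup>2 = (step_variance / (4 * L\<^sup>2)) * m\<^sup>2 * (1/4)" unfolding a_def by simp
          ultimately show ?thesis by simp
        qed
        also have "\<dots> = r ^ nat \<bar>int j - int k\<bar>"
          unfolding r_def m by (simp add: exp_of_nat_mult[symmetric] mult.commute)
        finally have "\<bar>\<phi> ((real j - real k) * \<eta>) ^ n\<bar> \<le> r ^ nat \<bar>int j - int k\<bar>" by (simp add: power_abs)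
        moreover have "\<phi> ((real j - real k) * \<eta>) ^ n * cos ((real j - real k) * \<eta> * (x - z))
            \<le> \<bar>\<phi> ((real j - real k) * \<eta>) ^ n\<bar> * 1"
          by (rule order_trans[OF abs_ge_self]) (simp add: abs_mult mult_left_le)
        ultimately show ?thesis by linarith
      qed
      then have "(\<Sum>k<N. \<phi> ((real j - real k) * \<eta>) ^ n * cos ((real j - real k) * \<eta> * (x - z)))
          \<le> (\<Sum>k<N. r ^ nat \<bar>int j - int k\<bar>)" by (intro sum_mono) auto
      also have "\<dots> \<le> 2 / (1 - r)" by (rule sum_power_abs_diff_le[OF r])
      finally show ?thesis .
    qed
    \<comment> \<open>There are \<open>N\<close> rows, and on the window the kernel is at least \<open>N\<^sup>2 / 4\<close>.\<close>
    have "(avg ^^ n) (window z (z + L)) x \<le> (avg ^^ n) (\<lambda>y. 4 / (real N)\<^sup>2 * F (y + - z)) x"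
      by (rule avg_pow_mono) (use F_low in simp)
    also have "\<dots> = 4 / (real N)\<^sup>2 * (avg ^^ n) F (x - z)"
      by (simp only: avg_pow_cmult avg_pow_shift) simp
    also have "\<dots> \<le> 4 / (real N)\<^sup>2 * (real N * (2 / (1 - r)))"
    proof (intro mult_left_mono)
      have "(avg ^^ n) F (x - z) = (\<Sum>j<N. \<Sum>k<N. \<phi> ((real j - real k) * \<eta>) ^ n * cos ((real j - real k) * \<eta> * (x - z)))"
        unfolding F_def by (simp add: avg_pow_sum avg_pow_cos)
      also have "\<dots> \<le> (\<Sum>j<N. 2 / (1 - r))" by (intro sum_mono inner) auto
      finally show "(avg ^^ n) F (x - z) \<le> real N * (2 / (1 - r))" by simp
    qed simp
    also have "4 / (real N)\<^sup>2 * (real N * (2 / (1 - r))) = D / real N"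
      unfolding D_def using Npos by (simp add: power2_eq_square)
    also have "D / real N \<le> D / sqrt (real n)" using N s1 D Npos n by (intro divide_left_mono mult_pos_pos) auto
    finally show ?thesis .
  qed
  show ?thesis
  proof (rule that[of "2 * D"])
    show "2 * D \<ge> 1" using D by simp
    fix n z x
    show "(avg ^^ n) (window z (z + L)) x \<le> 2 * D / sqrt (real n + 1)"
    proof (cases "n = 0")
      case True
      then show ?thesis using D by (simp add: window_def)
    next
      case False
      then have "sqrt (real n + 1) \<le> sqrt (4 * real n)" by (intro real_sqrt_le_mono) linarith
      then have "sqrt (real n + 1) \<le> 2 * sqrt (real n)" by (simp add: real_sqrt_mult)
      then have "D / sqrt (real n) \<le> 2 * D / sqrt (real n + 1)"
        using D False by (simp add: field_simps)
      then show ?thesis using main[of n z x] False by simp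
    qed
  qed
qed

lemma avg_pow_add: "(avg ^^ n) (\<lambda>y. f y + g y) x = (avg ^^ n) f x + (avg ^^ n) g x"
proof (induction n arbitrary: x)
  case (Suc n)
  then have "(avg ^^ n) (\<lambda>y. f y + g y) = (\<lambda>x. (avg ^^ n) f x + (avg ^^ n) g x)" by auto
  then show ?case by (simp add: avg_add)
qed simp

lemma killed_eq_0: "x > 0 \<Longrightarrow> killed n f x = 0"
  by (cases n) (simp_all add: on_nonpos_def)

text \<open>
  In \<open>n\<close> steps the walk covers at most the distance \<open>n * L\<close>.
\<close>

lemma killed_mono_local:
  assumes "\<And>y. y \<le> 0 \<Longrightarrow> \<bar>y - x\<bar> \<le> real n * L \<Longrightarrow> f y \<le> g y"
  shows "killed n f x \<le> killed n g x"
  using assms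
proof (induction n arbitrary: x)
  case 0
  then show ?case by (auto simp: on_nonpos_def)
next
  case (Suc n)
  have "avg (killed n f) x \<le> avg (killed n g) x"
  proof (rule avg_mono, rule Suc.IH)
    fix i y assume *: "i \<in> S" "y \<le> 0" "\<bar>y - (x + s i)\<bar> \<le> real n * L"
    then have "\<bar>y - x\<bar> \<le> real (Suc n) * L" using step_le[OF *(1)] by (simp add: algebra_simps)
    then show "f y \<le> g y" using Suc.prems * by auto
  qed
  then show ?case by (simp add: on_nonpos_def)
qed

lemma killed_mono: "(\<And>y. y \<le> 0 \<Longrightarrow> f y \<le> g y) \<Longrightarrow> killed n f x \<le> killed n g x"
  by (rule killed_mono_local)

lemma killed_cmult: "killed n (\<lambda>y. c * f y) x = c * killed n f x"
proof (induction n arbitrary: x)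
  case (Suc n)
  then have "killed n (\<lambda>y. c * f y) = (\<lambda>x. c * killed n f x)" by auto
  then show ?case by (simp add: avg_cmult on_nonpos_def)
qed (simp add: on_nonpos_def)

lemma killed_zero: "killed n (\<lambda>_. 0) x = 0"
  using killed_cmult[of n 0 "\<lambda>_. 0"] by simp

lemma killed_nonneg: "(\<And>y. y \<le> 0 \<Longrightarrow> 0 \<le> f y) \<Longrightarrow> 0 \<le> killed n f x"
  using killed_mono[of "\<lambda>_. 0" f n x] by (simp add: killed_zero)

lemma killed_sum: "killed n (\<lambda>y. \<Sum>i\<in>I. f i y) x = (\<Sum>i\<in>I. killed n (f i) x)"
proof (induction n arbitrary: x)
  case (Suc n)
  then have "killed n (\<lambda>y. \<Sum>i\<in>I. f i y) = (\<lambda>x. \<Sum>i\<in>I. killed n (f i) x)" by auto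
  then show ?case by (simp add: avg_sum on_nonpos_def)
qed (simp add: on_nonpos_def)

lemma killed_add: "killed (m + n) f = killed m (killed n f)"
proof (induction m)
  case 0
  show ?case by (cases n) (simp_all add: on_nonpos_def fun_eq_iff)
qed simp

lemma killed_le_Tn:
  assumes "\<And>y. 0 \<le> f y" shows "killed n f x \<le> (avg ^^ n) f x"
proof (induction n arbitrary: x)
  case 0
  then show ?case using assms by (simp add: on_nonpos_def)
next
  case (Suc n)
  have "0 \<le> (avg ^^ Suc n) f x" using avg_pow_mono[of "\<lambda>_. 0" f "Suc n" x] assms by (simp only: avg_pow_const)
  moreover have "avg (killed n f) x \<le> avg ((avg ^^ n) f) x" by (rule avg_mono) (rule Suc.IH)
  ultimately show ?case by (simp add: on_nonpos_def)
qed

definition survival :: "nat \<Rightarrow> real \<Rightarrow> real" where "survival n = killed n (\<lambda>_. 1)"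

lemma survival_nonneg: "0 \<le> survival n x"
  unfolding survival_def by (rule killed_nonneg) simp

text \<open>
  The function \<open>y \<mapsto> sgn (L - y)\<close> is odd about \<open>L\<close> and decreasing, and \<open>avg\<close> preserves both properties. Hence
  its iterates are nonnegative to the left of \<open>L\<close>, which covers every point that the walk can reach by its first
  step into the positive half-line, so that they dominate the survival probability by induction.
\<close>

lemma survival_le_sgn:
  assumes "x \<le> L" shows "survival n x \<le> (avg ^^ n) (\<lambda>y. sgn (L - y)) x"
  using assms
proof (induction n arbitrary: x)
  case 0
  then show ?case using L_pos by (auto simp: survival_def on_nonpos_def sgn_if)
next
  case (Suc n)
  let ?\<sigma> = "\<lambda>y. sgn (L - y)"
  have nonneg: "0 \<le> (avg ^^ m) ?\<sigma> y" if y: "y \<le> L" for y m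
  proof -
    have "(avg ^^ m) ?\<sigma> (2 * L - y) = (avg ^^ m) (\<lambda>u. - 1 * ?\<sigma> u) y"
      unfolding avg_pow_reflect[symmetric] by (simp add: sgn_minus[symmetric])
    also have "\<dots> = - (avg ^^ m) ?\<sigma> y" unfolding avg_pow_cmult by simp
    finally have 1: "(avg ^^ m) ?\<sigma> (2 * L - y) = - (avg ^^ m) ?\<sigma> y" .
    have "(avg ^^ m) ?\<sigma> (2 * L - y) = (avg ^^ m) (\<lambda>u. ?\<sigma> (u + (2 * L - 2 * y))) y"
      using avg_pow_shift[of m ?\<sigma> "2 * L - 2 * y" y] by simp
    also have "\<dots> \<le> (avg ^^ m) ?\<sigma> y" by (rule avg_pow_mono) (use y in \<open>auto simp: sgn_if\<close>)
    finally show ?thesis using 1 by linarith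
  qed
  show ?case
  proof (cases "x \<le> 0")
    case True
    have "avg (survival n) x \<le> avg ((avg ^^ n) ?\<sigma>) x"
    proof (rule avg_mono, rule Suc.IH)
      fix i assume "i \<in> S"
      then show "x + s i \<le> L" using step_le[of i] True by auto
    qed
    then show ?thesis using True by (simp add: survival_def on_nonpos_def)
  next
    case False
    then show ?thesis using nonneg[OF Suc.prems, of "Suc n"] by (simp add: survival_def on_nonpos_def)
  qed
qed

lemma window_cover:
  assumes "a \<le> b"
  shows "window a b y \<le> (\<Sum>i<nat \<lfloor>(b - a) / L\<rfloor> + 1. window (a + real i * L) (a + real i * L + L) y)"
proof (cases "a \<le> y \<and> y \<le> b")
  case True
  define i where "i = nat \<lfloor>(y - a) / L\<rfloor>"
  have "(y - a) / L \<le> (b - a) / L" using True L_pos by (simp add: divide_right_mono)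
  then have i: "i < nat \<lfloor>(b - a) / L\<rfloor> + 1" unfolding i_def by (simp add: floor_mono nat_mono le_imp_less_Suc)
  have "0 \<le> (y - a) / L" using True L_pos by simp
  then have "real i \<le> (y - a) / L" "(y - a) / L \<le> real i + 1" unfolding i_def by linarith+
  then have "real i * L \<le> y - a" "y - a \<le> (real i + 1) * L" using L_pos by (simp_all add: field_simps)
  then have "window (a + real i * L) (a + real i * L + L) y = 1" by (simp add: window_def algebra_simps)
  moreover have "window (a + real i * L) (a + real i * L + L) y \<le>
      (\<Sum>i<nat \<lfloor>(b - a) / L\<rfloor> + 1. window (a + real i * L) (a + real i * L + L) y)"
    by (rule member_le_sum) (use i in \<open>auto simp: window_def\<close>)
  ultimately show ?thesis using True by (simp add: window_def)
next
  case False
  then show ?thesis by (auto simp: window_def intro!: sum_nonneg)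
qed

text \<open>
  By symmetry \<open>(avg ^^ n) (\<lambda>y. sgn (L - y)) x\<close> is the expectation of half the sum of the sign function and its reflection
  in \<open>x\<close>. The two cancel outside the interval from \<open>2 * x - L\<close> to \<open>L\<close>, which is covered by
  \<open>O(1 + \<bar>x\<bar>)\<close> windows.
\<close>

lemma survival_bound:
  obtains C where "C \<ge> 1" "\<And>n x. survival n x \<le> C * (1 + \<bar>x\<bar>) / sqrt (real n + 1)"
proof -
  obtain C where C: "C \<ge> 1" "\<And>n z x. (avg ^^ n) (window z (z + L)) x \<le> C / sqrt (real n + 1)"
    by (rule window_bound) blast
  \<comment> \<open>Positive starting points have survival probability \<open>0\<close>.\<close>
  have main: "survival n x \<le> C * (4 + 2 / L) * (1 + \<bar>x\<bar>) / sqrt (real n + 1)" if x: "x \<le> 0" for n x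
  proof -
    let ?\<sigma> = "\<lambda>y. sgn (L - y)"
    \<comment> \<open>The number of windows that cover the interval from \<open>2 * x - L\<close> to \<open>L\<close>.\<close>
    define m where "m = nat \<lfloor>(L - (2 * x - L)) / L\<rfloor> + 1"
    have "0 \<le> (L - (2 * x - L)) / L" using x L_pos by simp
    then have "real m \<le> (L - (2 * x - L)) / L + 1" unfolding m_def by linarith
    also have "\<dots> = 3 + 2 / L * \<bar>x\<bar>" using x L_pos by (simp add: field_simps)
    also have "\<dots> \<le> (4 + 2 / L) * (1 + \<bar>x\<bar>)" using L_pos by (simp add: field_simps)
    finally have m: "real m \<le> (4 + 2 / L) * (1 + \<bar>x\<bar>)" .
    have "2 * (avg ^^ n) ?\<sigma> x = (avg ^^ n) ?\<sigma> x + (avg ^^ n) ?\<sigma> (2 * x - x)" by simp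
    also have "\<dots> = (avg ^^ n) (\<lambda>y. ?\<sigma> y + ?\<sigma> (2 * x - y)) x"
      by (simp only: avg_pow_reflect[of n ?\<sigma> "2 * x" x, symmetric] avg_pow_add)
    also have "\<dots> \<le> (avg ^^ n) (\<lambda>y. 2 * (\<Sum>i<m. window (2 * x - L + real i * L) (2 * x - L + real i * L + L) y)) x"
    proof (rule avg_pow_mono)
      fix y
      have "?\<sigma> y + ?\<sigma> (2 * x - y) \<le> 2 * window (2 * x - L) L y"
        using x L_pos by (auto simp: sgn_if window_def)
      then show "?\<sigma> y + ?\<sigma> (2 * x - y) \<le> 2 * (\<Sum>i<m. window (2 * x - L + real i * L) (2 * x - L + real i * L + L) y)"
        using window_cover[of "2 * x - L" L y] x L_pos unfolding m_def by linarith
    qed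
    also have "\<dots> \<le> 2 * (\<Sum>i<m. C / sqrt (real n + 1))"
      unfolding avg_pow_cmult avg_pow_sum by (intro mult_left_mono sum_mono C(2)) auto
    also have "\<dots> = 2 * (C / sqrt (real n + 1) * real m)" by simp
    also have "\<dots> \<le> 2 * (C / sqrt (real n + 1) * ((4 + 2 / L) * (1 + \<bar>x\<bar>)))"
      using m C(1) by (intro mult_left_mono) auto
    finally have "(avg ^^ n) ?\<sigma> x \<le> C * (4 + 2 / L) * (1 + \<bar>x\<bar>) / sqrt (real n + 1)" by simp
    moreover have "survival n x \<le> (avg ^^ n) ?\<sigma> x" using x L_pos by (intro survival_le_sgn) auto
    ultimately show ?thesis by linarith
  qed
  show ?thesis
  proof (rule that)
    have "1 * 1 \<le> C * (4 + 2 / L)" using C(1) L_pos by (intro mult_mono) auto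
    then show "1 \<le> C * (4 + 2 / L)" by simp
    fix n x
    show "survival n x \<le> C * (4 + 2 / L) * (1 + \<bar>x\<bar>) / sqrt (real n + 1)"
      using main[of x n] C(1) L_pos by (cases "x \<le> 0") (auto simp: survival_def killed_eq_0)
  qed
qed

text \<open>
  Time reversal of the confined part. A path that ends in the window at \<open>z\<close> is read backwards from
  its end: if it stays nonpositive, then its reversal survives from \<open>z\<close>, and the \<open>b\<close> free steps
  still have to hit a window of length \<open>L\<close>. The induction peels off the last step.
\<close>

lemma avg_pow_killed_window_le:
  assumes M: "0 \<le> M" "\<And>z x. (avg ^^ b) (window z (z + L)) x \<le> M"
  shows "(avg ^^ b) (killed c (window z (z + L))) x \<le> M * survival c z"
proof (induction c arbitrary: z x)
  case 0
  have "(avg ^^ b) (killed 0 (window z (z + L))) x \<le> (avg ^^ b) (\<lambda>y. of_bool (z \<le> 0) * window z (z + L) y) x"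
    by (rule avg_pow_mono) (auto simp: on_nonpos_def window_def)
  also have "\<dots> = of_bool (z \<le> 0) * (avg ^^ b) (window z (z + L)) x" by (simp only: avg_pow_cmult)
  also have "\<dots> \<le> M * survival 0 z" using M by (auto simp: survival_def on_nonpos_def)
  finally show ?case .
next
  case (Suc c)
  have step: "killed 1 (window z (z + L)) y \<le>
      of_bool (z \<le> 0) * (\<Sum>i\<in>S. p i * (of_bool (z - s i \<le> 0) * window (z - s i) (z - s i + L) y))"
    if "y \<le> 0" for y
  proof -
    have "killed 1 (window z (z + L)) y = (\<Sum>i\<in>S. p i * on_nonpos (window z (z + L)) (y + s i))"
      using that by (simp add: on_nonpos_def[of "avg _"] avg_def)
    also have "\<dots> \<le> (\<Sum>i\<in>S. p i * (of_bool (z \<le> 0) * (of_bool (z - s i \<le> 0) * window (z - s i) (z - s i + L) y)))"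
      by (intro sum_mono mult_left_mono p_nonneg) (use that in \<open>auto simp: on_nonpos_def window_def\<close>)
    finally show ?thesis by (simp add: sum_distrib_left mult_ac)
  qed
  have "(avg ^^ b) (killed (Suc c) (window z (z + L))) x = (avg ^^ b) (killed c (killed 1 (window z (z + L)))) x"
    using killed_add[of c 1] by simp
  also have "\<dots> \<le> (avg ^^ b) (killed c (\<lambda>y. of_bool (z \<le> 0) *
      (\<Sum>i\<in>S. p i * (of_bool (z - s i \<le> 0) * window (z - s i) (z - s i + L) y)))) x"
    by (intro avg_pow_mono killed_mono step)
  also have "\<dots> = of_bool (z \<le> 0) * (\<Sum>i\<in>S. p i * (of_bool (z - s i \<le> 0) *
      (avg ^^ b) (killed c (window (z - s i) (z - s i + L))) x))"
    unfolding ext[OF killed_cmult] ext[OF killed_sum] avg_pow_cmult avg_pow_sum ..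
  also have "\<dots> \<le> of_bool (z \<le> 0) * (\<Sum>i\<in>S. p i * (M * survival c (z - s i)))"
  proof (intro mult_left_mono sum_mono p_nonneg)
    fix i
    show "of_bool (z - s i \<le> 0) * (avg ^^ b) (killed c (window (z - s i) (z - s i + L))) x \<le> M * survival c (z - s i)"
      using Suc.IH[of "z - s i" x] survival_nonneg[of c "z - s i"] M(1) by auto
  qed auto
  also have "(\<Sum>i\<in>S. p i * (M * survival c (z - s i))) = M * avg (survival c) z"
    using symmetric_law[of "\<lambda>u. survival c (z - u)"] unfolding avg_def
    by (simp add: sum_distrib_left[symmetric] mult.left_commute[of _ M])
  also have "of_bool (z \<le> 0) * (M * avg (survival c) z) = M * survival (Suc c) z"
    by (simp add: survival_def on_nonpos_def)
  finally show ?case .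
qed

text \<open>
  Split the time into three parts of length about \<open>n / 3\<close>. The first costs the survival probability from
  \<open>x\<close>, the last, reversed in time, the survival probability from \<open>z\<close>, and the middle one, on which the constraint is
  dropped, the probability of hitting a window. Each of the three factors is of order \<open>n powr (- 1 / 2)\<close>.
\<close>

lemma killed_window_bound:
  obtains C where "C > 0"
    "\<And>n z x. killed n (window z (z + L)) x \<le> C * (1 + \<bar>x\<bar>) * (1 + \<bar>z\<bar>) * (real n + 1) powr (- 3 / 2)"
proof -
  obtain A where A: "A \<ge> 1" "\<And>n z x. (avg ^^ n) (window z (z + L)) x \<le> A / sqrt (real n + 1)"
    by (rule window_bound) blast
  obtain B where B: "B \<ge> 1" "\<And>n x. survival n x \<le> B * (1 + \<bar>x\<bar>) / sqrt (real n + 1)"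
    by (rule survival_bound) blast
  show ?thesis
  proof (rule that)
    show "B * A * B * (sqrt 3 * sqrt 3 * sqrt 3) > 0" using A(1) B(1) by simp
    fix n :: nat and z x
    define a where "a = n div 3"
    define c where "c = n - 2 * a"
    have n: "n = a + (a + c)" and "n \<le> 3 * a + 2" and ca: "c \<ge> a" unfolding a_def c_def by linarith+
    have third: "1 / sqrt (real k + 1) \<le> sqrt 3 / sqrt (real n + 1)" if "k \<ge> a" for k
    proof -
      have "n + 1 \<le> 3 * (k + 1)" using \<open>n \<le> 3 * a + 2\<close> that by presburger
      then have "real (n + 1) \<le> real (3 * (k + 1))" by (simp only: of_nat_le_iff)
      then have "real n + 1 \<le> 3 * (real k + 1)" by simp
      then have "sqrt (real n + 1) \<le> sqrt (3 * (real k + 1))" by (rule real_sqrt_le_mono)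
      then have "sqrt (real n + 1) \<le> sqrt 3 * sqrt (real k + 1)" by (simp only: real_sqrt_mult)
      then show ?thesis by (simp add: divide_simps mult.commute)
    qed
    define r where "r = sqrt 3 / sqrt (real n + 1)"
    have r: "r > 0" unfolding r_def by simp
    have sv: "survival k y \<le> B * (1 + \<bar>y\<bar>) * r" if "k \<ge> a" for k y
      using order_trans[OF B(2)[of k y], of "B * (1 + \<bar>y\<bar>) * r"] mult_left_mono[OF third[OF that], of "B * (1 + \<bar>y\<bar>)"] B(1)
      unfolding r_def by simp
    have Ar: "(avg ^^ a) (window z (z + L)) x \<le> A * r" for z x
      using order_trans[OF A(2)[of a z x], of "A * r"] mult_left_mono[OF third[of a], of A] A(1) unfolding r_def by simp
    have "killed n (window z (z + L)) x = killed a (killed a (killed c (window z (z + L)))) x"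
      unfolding n killed_add ..
    also have "\<dots> \<le> killed a (\<lambda>_. A * r * survival c z * 1) x"
    proof (rule killed_mono)
      fix y
      have "killed a (killed c (window z (z + L))) y \<le> (avg ^^ a) (killed c (window z (z + L))) y"
        by (intro killed_le_Tn killed_nonneg) (auto simp: window_def)
      also have "\<dots> \<le> A * r * survival c z" using A(1) r Ar by (intro avg_pow_killed_window_le) auto
      finally show "killed a (killed c (window z (z + L))) y \<le> A * r * survival c z * 1" by simp
    qed
    also have "\<dots> = A * r * survival c z * survival a x" unfolding killed_cmult survival_def ..
    also have "\<dots> \<le> A * r * (B * (1 + \<bar>z\<bar>) * r) * (B * (1 + \<bar>x\<bar>) * r)"
      using A(1) B(1) r ca by (intro mult_mono sv survival_nonneg mult_nonneg_nonneg) auto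
    also have "\<dots> = A * B * B * (1 + \<bar>x\<bar>) * (1 + \<bar>z\<bar>) * (r * r * r)" by simp
    also have "r * r * r = (sqrt 3 * sqrt 3 * sqrt 3) * (real n + 1) powr (- 3 / 2)"
    proof -
      have "(real n + 1) powr (3 / 2) = (real n + 1) powr (1 / 2 + 1 / 2 + 1 / 2)" by simp
      also have "\<dots> = sqrt (real n + 1) * sqrt (real n + 1) * sqrt (real n + 1)"
        unfolding powr_add by (simp add: powr_half_sqrt)
      finally show ?thesis unfolding r_def by (simp add: powr_minus divide_simps)
    qed
    finally show "killed n (window z (z + L)) x \<le>
        B * A * B * (sqrt 3 * sqrt 3 * sqrt 3) * (1 + \<bar>x\<bar>) * (1 + \<bar>z\<bar>) * (real n + 1) powr (- 3 / 2)"
      by (simp add: mult_ac)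
  qed
qed

text \<open>
  Cut the half-line into windows. The exponential decay outweighs the linear growth in \<open>z\<close> of the
  preceding bound.
\<close>

lemma killed_exp_bound:
  obtains C where "C > 0"
    "\<And>n. killed n (\<lambda>y. exp y * (1 + \<bar>y\<bar>)) 0 \<le> C * (real n + 1) powr (- 3 / 2)"
proof -
  obtain C where C: "C > 0"
    "\<And>n z x. killed n (window z (z + L)) x \<le> C * (1 + \<bar>x\<bar>) * (1 + \<bar>z\<bar>) * (real n + 1) powr (- 3 / 2)"
    by (rule killed_window_bound) blast
  define g where "g i = exp (- real i * L) * (1 + (real i + 1) * L)" for i :: nat
  define r where "r = exp (- L / 2)"
  have r: "0 < r" "r < 1" unfolding r_def using L_pos by auto
  have g0: "g i \<ge> 0" for i unfolding g_def using L_pos by simp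
  \<comment> \<open>Here \<open>1 + y \<le> 4 * exp (y / 4)\<close> absorbs both linear factors.\<close>
  have gsum: "(\<Sum>i<m. g i * (1 + (real i + 1) * L)) \<le> 16 * exp (L / 2) * (1 / (1 - r))" for m
  proof -
    have "g i * (1 + (real i + 1) * L) \<le> 16 * exp (L / 2) * r ^ i" for i
    proof -
      define y where "y = (real i + 1) * L"
      have y: "y \<ge> 0" unfolding y_def using L_pos by simp
      have "1 + y \<le> 4 * exp (y / 4)" using exp_ge_add_one_self[of "y / 4"] y by linarith
      then have "(1 + y)\<^sup>2 \<le> (4 * exp (y / 4))\<^sup>2" using y by (intro power_mono) auto
      also have "\<dots> = 16 * exp (y / 2)" by (simp add: power_mult_distrib exp_of_nat_mult[symmetric])
      finally have "exp (- real i * L) * (1 + y)\<^sup>2 \<le> exp (- real i * L) * (16 * exp (y / 2))" by simp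
      also have "\<dots> = 16 * exp (L / 2) * r ^ i"
        unfolding r_def y_def by (simp add: exp_of_nat_mult[symmetric] exp_add[symmetric] field_simps)
      finally show ?thesis unfolding g_def y_def by (simp add: power2_eq_square mult_ac)
    qed
    then have "(\<Sum>i<m. g i * (1 + (real i + 1) * L)) \<le> (\<Sum>i<m. 16 * exp (L / 2) * r ^ i)" by (intro sum_mono)
    also have "\<dots> = 16 * exp (L / 2) * (\<Sum>i<m. r ^ i)" by (simp add: sum_distrib_left)
    also have "(\<Sum>i<m. r ^ i) \<le> 1 / (1 - r)"
      using sum_le_suminf[of "(^) r" "{..<m}"] suminf_geometric[of r] r by (auto intro: summable_geometric)
    finally show ?thesis by (simp add: mult_left_mono)
  qed
  show ?thesis
  proof (rule that)
    show "C * (16 * exp (L / 2) * (1 / (1 - r))) > 0" using C r by simp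
    fix n
    have "killed n (\<lambda>y. exp y * (1 + \<bar>y\<bar>)) 0 \<le> killed n (\<lambda>y. \<Sum>i<n+1. g i * window (- (real i + 1) * L) (- (real i + 1) * L + L) y) 0"
    proof (rule killed_mono_local)
      fix y :: real assume y: "y \<le> 0" "\<bar>y - 0\<bar> \<le> real n * L"
      define i where "i = nat \<lfloor>- y / L\<rfloor>"
      have "0 \<le> - y / L" "- y / L \<le> real n" using y L_pos by (simp_all add: field_simps)
      then have "real i \<le> - y / L" "- y / L \<le> real i + 1" and i: "i < n + 1" unfolding i_def by linarith+
      then have yi: "real i * L \<le> - y" "- y \<le> (real i + 1) * L" using L_pos by (simp_all add: field_simps)
      then have w: "window (- (real i + 1) * L) (- (real i + 1) * L + L) y = 1" by (simp add: window_def algebra_simps)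
      have "exp y * (1 + \<bar>y\<bar>) \<le> g i"
        unfolding g_def using yi y by (intro mult_mono) auto
      also have "\<dots> = g i * window (- (real i + 1) * L) (- (real i + 1) * L + L) y" using w by simp
      also have "\<dots> \<le> (\<Sum>i<n+1. g i * window (- (real i + 1) * L) (- (real i + 1) * L + L) y)"
        by (rule member_le_sum) (use i g0 in \<open>auto simp: window_def\<close>)
      finally show "exp y * (1 + \<bar>y\<bar>) \<le> (\<Sum>i<n+1. g i * window (- (real i + 1) * L) (- (real i + 1) * L + L) y)" .
    qed
    also have "\<dots> = (\<Sum>i<n+1. g i * killed n (window (- (real i + 1) * L) (- (real i + 1) * L + L)) 0)"
      by (simp only: killed_sum killed_cmult)
    also have "\<dots> \<le> (\<Sum>i<n+1. g i * (C * (1 + (real i + 1) * L) * (real n + 1) powr (- 3 / 2)))"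
    proof (intro sum_mono mult_left_mono g0)
      fix i
      have "\<bar>- (real i + 1) * L\<bar> = (real i + 1) * L" using L_pos by (simp add: abs_mult)
      then show "killed n (window (- (real i + 1) * L) (- (real i + 1) * L + L)) 0 \<le> C * (1 + (real i + 1) * L) * (real n + 1) powr (- 3 / 2)"
        using C(2)[of n "- (real i + 1) * L" 0] by simp
    qed
    also have "\<dots> = C * (real n + 1) powr (- 3 / 2) * (\<Sum>i<n+1. g i * (1 + (real i + 1) * L))"
      unfolding sum_distrib_left by (simp only: mult_ac)
    also have "\<dots> \<le> C * (real n + 1) powr (- 3 / 2) * (16 * exp (L / 2) * (1 / (1 - r)))"
      by (intro mult_left_mono gsum) (use C(1) in auto)
    finally show "killed n (\<lambda>y. exp y * (1 + \<bar>y\<bar>)) 0 \<le> C * (16 * exp (L / 2) * (1 / (1 - r))) * (real n + 1) powr (- 3 / 2)"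
      by (simp add: mult_ac)
  qed
qed

end

section \<open>The modular function and mass transport\<close>

text \<open>
  The inverse of an automorphism is written \<open>inv_into UNIV\<close> because \<open>inv\<close> alone may also denote the inverse of an abstract group.
\<close>

locale transitive_graph =
  fixes E :: "'v rel" and \<Gamma> :: "('v \<Rightarrow> 'v) set" and v0 :: 'v
  assumes E_sym: "sym E"
    and finite_nbrs: "finite (E `` {x})"
    and connected: "(x, y) \<in> E\<^sup>*"
    and id_in: "id \<in> \<Gamma>"
    and comp_in: "g \<in> \<Gamma> \<Longrightarrow> k \<in> \<Gamma> \<Longrightarrow> g \<circ> k \<in> \<Gamma>"
    and inv_in: "g \<in> \<Gamma> \<Longrightarrow> inv_into UNIV g \<in> \<Gamma>"
    and bij_in: "g \<in> \<Gamma> \<Longrightarrow> bij g"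
    and edge_iff: "g \<in> \<Gamma> \<Longrightarrow> (g x, g y) \<in> E \<longleftrightarrow> (x, y) \<in> E"
    and transitive: "\<exists>g\<in>\<Gamma>. g x = y"
begin

lemma inv_apply [simp]: "g \<in> \<Gamma> \<Longrightarrow> inv_into UNIV g (g x) = x" and apply_inv [simp]: "g \<in> \<Gamma> \<Longrightarrow> g (inv_into UNIV g x) = x"
  using bij_in by (auto simp: bij_is_inj bij_is_surj surj_f_inv_f)

lemma inj_in: "g \<in> \<Gamma> \<Longrightarrow> g x = g y \<longleftrightarrow> x = y"
  using bij_in by (metis bij_is_inj injD)

lemma nbrs_image: "g \<in> \<Gamma> \<Longrightarrow> E `` {g x} = g ` (E `` {x})"
proof -
  assume g: "g \<in> \<Gamma>"
  have "y \<in> g ` (E `` {x})" if "(g x, y) \<in> E" for y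
    using that edge_iff[OF g, of x "inv_into UNIV g y"] g by (auto intro!: image_eqI[of _ _ "inv_into UNIV g y"])
  then show ?thesis using edge_iff[OF g] by auto
qed

definition ball :: "nat \<Rightarrow> 'v \<Rightarrow> 'v set" where "ball n x = ((E \<union> Id) ^^ n) `` {x}"

lemma ball_0: "ball 0 x = {x}"
  by (auto simp: ball_def)

lemma ball_Suc: "ball (Suc n) x = (\<Union>y\<in>insert x (E `` {x}). ball n y)"
  unfolding ball_def relpow.simps(2) relpow_commute[symmetric] by blast

lemma finite_ball: "finite (ball n x)"
  by (induction n arbitrary: x) (auto simp: ball_0 ball_Suc finite_nbrs)

lemma center_in_ball: "x \<in> ball n x"
  by (induction n) (auto simp: ball_0 ball_Suc)

lemma ball_sym: "y \<in> ball n x \<longleftrightarrow> x \<in> ball n y"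
proof -
  have "(b, a) \<in> (E \<union> Id) ^^ n" if "(a, b) \<in> (E \<union> Id) ^^ n" for a b
    using that
  proof (induction n arbitrary: b)
    case (Suc n)
    then obtain c where c: "(a, c) \<in> (E \<union> Id) ^^ n" "(c, b) \<in> E \<union> Id" by auto
    then have "(b, c) \<in> E \<union> Id" using E_sym by (auto dest: symD)
    then show ?case using relpow_Suc_I2 Suc.IH[OF c(1)] by metis
  qed simp
  then show ?thesis unfolding ball_def by auto
qed

lemma ball_image: "g \<in> \<Gamma> \<Longrightarrow> ball n (g x) = g ` ball n x"
  by (induction n arbitrary: x) (auto simp: ball_0 ball_Suc nbrs_image)

lemma ball_image_iff: "g \<in> \<Gamma> \<Longrightarrow> g y \<in> ball n (g x) \<longleftrightarrow> y \<in> ball n x"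
  by (auto simp: ball_image inj_in)

lemma nbrs_subset_ball: "E `` {x} \<subseteq> ball 1 x"
  by (auto simp: ball_Suc ball_0)

lemma in_some_ball: "\<exists>n. y \<in> ball n x"
proof -
  have "(x, y) \<in> (E \<union> Id)\<^sup>*" using connected[of x y] rtrancl_mono[of E "E \<union> Id"] by auto
  then show ?thesis unfolding ball_def using rtrancl_imp_relpow[of "(x, y)" "E \<union> Id"] by blast
qed

definition stab :: "'v set \<Rightarrow> ('v \<Rightarrow> 'v) set" where
  "stab F = {g \<in> \<Gamma>. \<forall>x\<in>F. g x = x}"

definition orb :: "'v set \<Rightarrow> 'v \<Rightarrow> 'v set" where
  "orb F y = (\<lambda>g. g y) ` stab F"

lemma finite_orb: "x \<in> F \<Longrightarrow> finite (orb F y)"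
proof -
  assume x: "x \<in> F"
  obtain n where n: "y \<in> ball n x" using in_some_ball by blast
  have "orb F y \<subseteq> ball n x"
  proof
    fix z assume "z \<in> orb F y"
    then obtain g where g: "g \<in> \<Gamma>" "g x = x" "z = g y" unfolding orb_def stab_def using x by auto
    then show "z \<in> ball n x" using ball_image_iff[OF g(1), of y n x] n by simp
  qed
  then show ?thesis using finite_ball finite_subset by blast
qed

lemma in_orb: "y \<in> orb F y"
  unfolding orb_def stab_def using id_in by (auto intro!: image_eqI[of _ _ id])

lemma card_orb_pos: "x \<in> F \<Longrightarrow> 0 < card (orb F y)"
  using finite_orb in_orb by (metis card_gt_0_iff empty_iff)

lemma orb_image: "g \<in> \<Gamma> \<Longrightarrow> orb (g ` F) (g y) = g ` orb F y"
proof -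
  have *: "g ` orb F y \<subseteq> orb (g ` F) (g y)" if g: "g \<in> \<Gamma>" for g F y
  proof
    fix z assume "z \<in> g ` orb F y"
    then obtain k where k: "k \<in> stab F" "z = g (k y)" unfolding orb_def by auto
    then have "g \<circ> k \<circ> inv_into UNIV g \<in> stab (g ` F)"
      unfolding stab_def using g by (auto intro: comp_in inv_in)
    moreover have "z = (g \<circ> k \<circ> inv_into UNIV g) (g y)" using k g by simp
    ultimately show "z \<in> orb (g ` F) (g y)" unfolding orb_def by blast
  qed
  assume g: "g \<in> \<Gamma>"
  have "inv_into UNIV g ` orb (g ` F) (g y) \<subseteq> orb F y"
    using *[OF inv_in[OF g], of "g ` F" "g y"] g by (simp add: image_image)
  then have "orb (g ` F) (g y) \<subseteq> g ` orb F y"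
    using g by (auto simp: image_subset_iff intro!: image_eqI[of _ g "inv_into UNIV g _"])
  then show ?thesis using *[OF g] by blast
qed

lemma card_orb_image: "g \<in> \<Gamma> \<Longrightarrow> card (orb {g x} (g y)) = card (orb {x} y)"
  using orb_image[of g "{x}" y] card_image[of g "orb {x} y"] bij_in[of g]
  by (simp add: bij_is_inj inj_on_subset[of g UNIV])

lemma stab_fibre:
  assumes "e \<in> stab F"
  shows "{g \<in> stab F. g y = e y} = (\<lambda>g. e \<circ> g) ` stab (insert y F)"
proof -
  have e: "e \<in> \<Gamma>" "\<And>x. x \<in> F \<Longrightarrow> e x = x" using assms by (auto simp: stab_def)
  have "\<exists>k\<in>stab (insert y F). g = e \<circ> k" if g: "g \<in> stab F" "g y = e y" for g
  proof
    have "inv_into UNIV e x = x" if "x \<in> F" for x using e that by (metis inv_apply)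
    then show "inv_into UNIV e \<circ> g \<in> stab (insert y F)"
      using g e by (auto simp: stab_def intro!: comp_in inv_in)
    show "g = e \<circ> (inv_into UNIV e \<circ> g)" using e by (auto simp: fun_eq_iff)
  qed
  then show ?thesis using e by (auto simp: stab_def intro!: comp_in)
qed

text \<open>
  The orbit of the pair \<open>(y, z)\<close> fibres over the orbit of \<open>y\<close>, with all fibres of the same size.
\<close>

lemma card_orb_pair:
  assumes x: "x \<in> F"
  shows "card ((\<lambda>g. (g y, g z)) ` stab F) = card (orb F y) * card (orb (insert y F) z)"
proof -
  define fib where "fib y' = (\<lambda>g. g z) ` {g \<in> stab F. g y = y'}" for y'
  have *: "(\<lambda>g. (g y, g z)) ` stab F = (SIGMA y':orb F y. fib y')"
    unfolding fib_def orb_def by (auto simp: image_iff) metis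
  have fib: "card (fib y') = card (orb (insert y F) z) \<and> finite (fib y')" if y': "y' \<in> orb F y" for y'
  proof -
    obtain e where e: "e \<in> stab F" "y' = e y" using y' unfolding orb_def by auto
    then have "fib y' = e ` orb (insert y F) z"
      unfolding fib_def orb_def using stab_fibre[OF e(1), of y] by (simp add: image_image)
    moreover have "inj e" using e bij_in bij_is_inj unfolding stab_def by auto
    moreover have "finite (orb (insert y F) z)" by (rule finite_orb[of y]) simp
    ultimately show ?thesis by (simp add: card_image inj_on_subset[of e UNIV])
  qed
  have "card (SIGMA y':orb F y. fib y') = (\<Sum>y'\<in>orb F y. card (fib y'))"
    by (rule card_SigmaI) (use fib finite_orb[OF x] in auto)
  then show ?thesis unfolding * using fib by simp
qed

text \<open>
  The logarithm of the modular function, seen on pairs of vertices: the ratio equals the quotient of the Haar measures of the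
  stabilisers of \<open>y\<close> and of \<open>x\<close>. It serves as the height of \<open>y\<close> relative to \<open>x\<close>.
\<close>

definition h :: "'v \<Rightarrow> 'v \<Rightarrow> real" where
  "h x y = ln (real (card (orb {y} x)) / real (card (orb {x} y)))"

lemma exp_h: "exp (h x y) = real (card (orb {y} x)) / real (card (orb {x} y))"
  unfolding h_def using card_orb_pos by (intro exp_ln divide_pos_pos) auto

lemma h_invariant: "g \<in> \<Gamma> \<Longrightarrow> h (g x) (g y) = h x y"
  unfolding h_def by (simp add: card_orb_image)

text \<open>
  Counting the orbit of a pair under the stabiliser of a third vertex in two ways gives a relation for each of
  the three vertices, and their product is the cocycle identity.
\<close>

lemma h_cocycle: "h x y + h y z = h x z"
proof -
  let ?c = "\<lambda>F y. real (card (orb F y))"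
  have pos: "?c {u} w > 0" "?c {u,v} w > 0" for u v w
    using card_orb_pos[of u "{u}" w] card_orb_pos[of u "{u,v}" w] by auto
  have swap: "?c {x} y * ?c {x,y} z = ?c {x} z * ?c {x,z} y" for x y z
  proof -
    have "(\<lambda>g. (g z, g y)) ` stab {x} = prod.swap ` (\<lambda>g. (g y, g z)) ` stab {x}"
      by (simp add: image_image)
    then have "card ((\<lambda>g. (g z, g y)) ` stab {x}) = card ((\<lambda>g. (g y, g z)) ` stab {x})"
      by (simp add: card_image)
    then show ?thesis
      using card_orb_pair[of x "{x}" y z] card_orb_pair[of x "{x}" z y]
      by (simp add: insert_commute of_nat_mult[symmetric] del: of_nat_mult)
  qed
  have "exp (h x y + h y z) = exp (h x z)"
  proof -
    have 1: "?c {x} y * ?c {x,y} z = ?c {x} z * ?c {x,z} y"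
     and 2: "?c {y} z * ?c {y,z} x = ?c {y} x * ?c {x,y} z"
     and 3: "?c {z} x * ?c {x,z} y = ?c {z} y * ?c {y,z} x"
      using swap[of x y z] swap[of y z x] swap[of z x y] by (simp_all add: insert_commute)
    have cancel: "xz * (yx * zy) = xy * (yz * zx)"
      if "xy * P = xz * Q" "yz * R = yx * P" "zx * Q = zy * R" "P > 0" "Q > 0" "R > 0"
      for xy yz zx xz yx zy P Q R :: real
    proof -
      have "(xz * Q) * (yx * P) * (zy * R) = (xy * P) * (yz * R) * (zx * Q)"
        by (simp only: that(1-3))
      then have "(xz * (yx * zy)) * (P * Q * R) = (xy * (yz * zx)) * (P * Q * R)" by (simp only: mult_ac)
      then show ?thesis using that(4-6) by simp
    qed
    show ?thesis unfolding exp_add exp_h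
      using cancel[OF 1 2 3 pos(2) pos(2) pos(2)] pos(1)[of x y] pos(1)[of y z] pos(1)[of x z] 
      by (simp add: field_simps)
  qed
  then show ?thesis by simp
qed

lemma h_self [simp]: "h x x = 0"
  using h_cocycle[of x x x] by simp

lemma h_swap: "h y x = - h x y"
  using h_cocycle[of x y x] by simp

text \<open>
  The mass-transport principle. Relate \<open>y\<close> to \<open>y'\<close> if some element of \<open>\<Gamma>\<close> moves the pair \<open>(u, y)\<close>
  to \<open>(y', u)\<close>. Each \<open>y\<close> has as many partners as its stabiliser moves \<open>u\<close> to different places, and the relation
  is symmetric, so both sides arise from one double sum over related pairs.
\<close>

theorem mass_transport:
  assumes f: "\<And>g x y. g \<in> \<Gamma> \<Longrightarrow> f (g x) (g y) = (f x y :: real)"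
  shows "(\<Sum>y\<in>ball n u. f u y) = (\<Sum>y\<in>ball n u. f y u * exp (h u y))"
proof -
  define B where "B = ball n u"
  define c where "c x y = real (card (orb {x} y))" for x y
  define R where "R y y' \<longleftrightarrow> (\<exists>g\<in>\<Gamma>. g u = y' \<and> g y = u)" for y y'
  have finB: "finite B" unfolding B_def by (rule finite_ball)
  have cpos: "c x y > 0" for x y unfolding c_def using card_orb_pos by auto
  have R_sym: "R y y' \<Longrightarrow> R y' y" for y y'
    unfolding R_def by (metis inv_in inv_apply)
  \<comment> \<open>Composing with a fixed \<open>g0\<close> that moves \<open>y\<close> to \<open>u\<close> identifies the partners of \<open>y\<close> with the orbit of \<open>u\<close> under the stabiliser of \<open>y\<close>.\<close>
  have R_card: "real (card {y'. y' \<in> B \<and> R y y'}) = c y u" if y: "y \<in> B" for y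
  proof -
    obtain g0 where g0: "g0 \<in> \<Gamma>" "g0 y = u" using transitive by blast
    have "{y'. y' \<in> B \<and> R y y'} = {g u | g. g \<in> \<Gamma> \<and> g y = u}"
    proof -
      have "g u \<in> B" if "g \<in> \<Gamma>" "g y = u" for g
        using ball_image_iff[OF that(1), of u n y] that y ball_sym unfolding B_def by auto
      then show ?thesis unfolding R_def by auto
    qed
    also have "\<dots> = g0 ` orb {y} u"
    proof -
      have "g u \<in> g0 ` orb {y} u" if "g \<in> \<Gamma>" "g y = u" for g
      proof -
        have "inv_into UNIV g0 (g y) = y" using that g0 by (metis inv_apply)
        then have "inv_into UNIV g0 \<circ> g \<in> stab {y}" using that g0 by (auto simp: stab_def intro!: comp_in inv_in)
        then show ?thesis unfolding orb_def using g0 by (auto intro!: image_eqI[of _ _ "inv_into UNIV g0 \<circ> g"] simp: image_image)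
      qed
      moreover have "\<exists>k. g0 (g u) = k u \<and> k \<in> \<Gamma> \<and> k y = u" if "g \<in> stab {y}" for g
        using that g0 by (intro exI[of _ "g0 \<circ> g"]) (auto simp: stab_def intro!: comp_in)
      ultimately show ?thesis unfolding orb_def by (auto simp: image_image)
    qed
    finally show ?thesis
      using bij_in[OF g0(1)] unfolding c_def by (simp add: card_image bij_is_inj inj_on_subset[of g0 UNIV])
  qed
  have R_eq: "f u y = f y' u \<and> c y u = c u y'" if "R y y'" for y y'
    using that f[of _ u y] unfolding R_def c_def by (metis card_orb_image)
  have "(\<Sum>y\<in>B. f u y) = (\<Sum>y\<in>B. \<Sum>y' | y' \<in> B \<and> R y y'. f u y / c y u)"
    by (intro sum.cong) (use R_card cpos in \<open>auto simp: less_imp_neq[OF cpos, symmetric]\<close>)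
  also have "\<dots> = (\<Sum>y\<in>B. \<Sum>y' | y' \<in> B \<and> R y y'. f y' u / c u y')"
    by (intro sum.cong) (use R_eq in auto)
  also have "\<dots> = (\<Sum>y'\<in>B. \<Sum>y | y \<in> B \<and> R y y'. f y' u / c u y')"
    by (rule sum.swap_restrict[OF finB finB])
  also have "\<dots> = (\<Sum>y'\<in>B. \<Sum>y | y \<in> B \<and> R y' y. f y' u / c u y')"
    using R_sym by (intro sum.cong) auto
  also have "\<dots> = (\<Sum>y'\<in>B. f y' u * exp (h u y'))"
    by (intro sum.cong) (use R_card in \<open>auto simp: exp_h c_def\<close>)
  finally show ?thesis unfolding B_def .
qed

lemma mass_transport_edges:
  assumes f: "\<And>g x y. g \<in> \<Gamma> \<Longrightarrow> f (g x) (g y) = (f x y :: real)"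
  shows "(\<Sum>y\<in>E `` {u}. f u y) = (\<Sum>y\<in>E `` {u}. f y u * exp (h u y))"
proof -
  let ?f = "\<lambda>x y. of_bool ((x, y) \<in> E) * f x y"
  have sub: "(\<Sum>y\<in>ball 1 u. of_bool ((u, y) \<in> E) * k y) = (\<Sum>y\<in>E `` {u}. k y)" for k :: "'v \<Rightarrow> real"
    by (rule sum.mono_neutral_cong_right) (use finite_ball nbrs_subset_ball in auto)
  have "(\<Sum>y\<in>ball 1 u. ?f u y) = (\<Sum>y\<in>ball 1 u. ?f y u * exp (h u y))"
    by (rule mass_transport) (simp add: f edge_iff)
  moreover have "(y, u) \<in> E \<longleftrightarrow> (u, y) \<in> E" for y using E_sym by (auto dest: symD)
  ultimately show ?thesis by (simp only: sub mult.assoc)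
qed

lemma sum_nbrs_invariant:
  assumes f: "\<And>g x y. g \<in> \<Gamma> \<Longrightarrow> f (g x) (g y) = (f x y :: real)"
  shows "(\<Sum>y\<in>E `` {u}. f u y) = (\<Sum>y\<in>E `` {w}. f w y)"
proof -
  obtain g where g: "g \<in> \<Gamma>" "g w = u" using transitive by blast
  have "(\<Sum>y\<in>E `` {g w}. f (g w) y) = (\<Sum>y\<in>E `` {w}. f w y)"
    unfolding nbrs_image[OF g(1)] using bij_in[OF g(1)] g(1)
    by (subst sum.reindex) (auto simp: f bij_is_inj inj_on_subset[of g UNIV])
  then show ?thesis using g by simp
qed

definition deg :: real where "deg = real (card (E `` {v0}))"

lemma card_nbrs: "real (card (E `` {x})) = deg"
  using sum_nbrs_invariant[of "\<lambda>_ _. 1" x v0] unfolding deg_def by simp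

text \<open>
  The factor by which the kernel \<open>exp (h x y / 2)\<close> has to be divided, besides the degree, to become stochastic. For
  amenable \<open>\<Gamma>\<close> it is the spectral radius.
\<close>

definition lam :: real where "lam = (\<Sum>z\<in>E `` {v0}. exp (h v0 z / 2)) / deg"

text \<open>
  The random walk tilted by the square root of the modular function. The exponent \<open>1 / 2\<close> is the one for
  which mass transport makes the law of the height increments symmetric.
\<close>

definition q :: "'v \<Rightarrow> 'v \<Rightarrow> real" where "q x y = exp (h x y / 2) / (deg * lam)"

lemma q_invariant: "g \<in> \<Gamma> \<Longrightarrow> q (g x) (g y) = q x y"
  unfolding q_def by (simp add: h_invariant)

lemma q_swap: "q y x * exp (h x y) = q x y"
  unfolding q_def h_swap[of y x] by (simp add: exp_add[symmetric])

lemma q_symmetric_law: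
  "(\<Sum>y\<in>E `` {u}. q u y * f (h u y)) = (\<Sum>y\<in>E `` {u}. q u y * f (- h u y))"
proof -
  have "(\<Sum>y\<in>E `` {u}. q u y * f (h u y)) = (\<Sum>y\<in>E `` {u}. q y u * f (h y u) * exp (h u y))"
    by (rule mass_transport_edges) (simp add: q_invariant h_invariant)
  also have "\<dots> = (\<Sum>y\<in>E `` {u}. (q y u * exp (h u y)) * f (- h u y))"
    by (simp add: h_swap[of _ u] mult_ac)
  finally show ?thesis unfolding q_swap .
qed

text \<open>
  Mass transport carries the drift of an antisymmetric quantity under the tilted walk to its negative.
\<close>

lemma q_antisymmetric_sum:
  assumes f: "\<And>g x y. g \<in> \<Gamma> \<Longrightarrow> f (g x) (g y) = (f x y :: real)"
    and anti: "\<And>x y. f y x = - f x y"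
  shows "(\<Sum>y\<in>E `` {u}. q u y * f u y) = 0"
proof -
  have "(\<Sum>y\<in>E `` {u}. q u y * f u y) = (\<Sum>y\<in>E `` {u}. q y u * f y u * exp (h u y))"
    by (rule mass_transport_edges) (simp add: q_invariant f)
  also have "\<dots> = (\<Sum>y\<in>E `` {u}. (q y u * exp (h u y)) * f y u)" by (simp add: mult_ac)
  also have "\<dots> = - (\<Sum>y\<in>E `` {u}. q u y * f u y)" unfolding q_swap anti[of _ u] by (simp add: sum_negf)
  finally show ?thesis by simp
qed

end

locale infinite_transitive_graph = transitive_graph E \<Gamma> v0
  for E :: "'v rel" and \<Gamma> v0 +
  assumes nbrs_nonempty: "E `` {v0} \<noteq> {}"
begin

lemma deg_pos: "deg > 0"
  unfolding deg_def using nbrs_nonempty finite_nbrs by (simp add: card_gt_0_iff)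

lemma lam_pos: "lam > 0"
  unfolding lam_def using nbrs_nonempty finite_nbrs deg_pos by (intro divide_pos_pos sum_pos) auto

lemma q_pos: "q x y > 0"
  unfolding q_def using deg_pos lam_pos by simp

lemma q_sum: "(\<Sum>y\<in>E `` {u}. q u y) = 1"
proof -
  have "(\<Sum>y\<in>E `` {u}. q u y) = (\<Sum>y\<in>E `` {v0}. q v0 y)"
    by (rule sum_nbrs_invariant) (rule q_invariant)
  also have "\<dots> = (deg * lam) / (deg * lam)"
    unfolding q_def sum_divide_distrib[symmetric] by (simp add: lam_def)
  finally show ?thesis using deg_pos lam_pos by simp
qed

end

section \<open>Loops seen from their highest vertex\<close>

text \<open>
  One of the two indices is at least \<open>n / 2\<close>, so the corresponding factor is at most a constant times \<open>(n + 1) powr (- 3 / 2)\<close>,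
  and the other factor is summable.
\<close>

lemma convolution_bound:
  obtains C :: real where "C > 0"
    "\<And>n. (\<Sum>k\<le>n. (real k + 1) powr (- 3 / 2) * (real (n - k) + 1) powr (- 3 / 2)) \<le> C * (real n + 1) powr (- 3 / 2)"
proof -
  define a where "a k = (real k + 1) powr (- 3 / 2)" for k :: nat
  have a: "a k > 0" for k unfolding a_def by simp
  have "summable (\<lambda>n. real n powr (- 3 / 2))" by (subst summable_real_powr_iff) simp
  then have sm: "summable a" unfolding a_def by (subst (asm) summable_Suc_iff[symmetric]) (simp add: add.commute)
  define D :: real where "D = (1 / 2) powr (- 3 / 2)"
  have D: "D > 0" unfolding D_def by simp
  have half: "a k \<le> D * a n" if "n + 1 \<le> 2 * (k + 1)" for k n
  proof -
    have "real (n + 1) \<le> real (2 * (k + 1))" using that by (simp only: of_nat_le_iff)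
    then have "(1 / 2) * (real n + 1) \<le> real k + 1" by simp
    then have "a k \<le> ((1 / 2) * (real n + 1)) powr (- 3 / 2)"
      unfolding a_def by (intro powr_mono2') auto
    then show ?thesis unfolding D_def a_def by (subst (asm) powr_mult) auto
  qed
  have split_term: "a k * a (n - k) \<le> D * a n * (a k + a (n - k))" if k: "k \<le> n" for k n
  proof (cases "n + 1 \<le> 2 * (k + 1)")
    case True
    then have "a k * a (n - k) \<le> D * a n * a (n - k)" using half a by (intro mult_right_mono) (auto simp: less_imp_le)
    moreover have "0 \<le> D * a n * a k" using D a by (simp add: less_imp_le)
    ultimately show ?thesis by (simp add: distrib_left)
  next
    case False
    then have "n + 1 \<le> 2 * ((n - k) + 1)" using k by presburger
    then have "a k * a (n - k) \<le> a k * (D * a n)" using half a by (intro mult_left_mono) (auto simp: less_imp_le)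
    moreover have "0 \<le> D * a n * a (n - k)" using D a by (simp add: less_imp_le)
    ultimately show ?thesis by (simp add: distrib_left mult_ac)
  qed
  have suma: "(\<Sum>k\<le>n. a k) \<le> suminf a" for n
    by (rule sum_le_suminf[OF sm]) (use a in \<open>auto simp: less_imp_le\<close>)
  show ?thesis
  proof (rule that)
    show "2 * D * (suminf a) > 0" using D suminf_pos[OF sm a] by simp
    fix n
    have "(\<Sum>k\<le>n. a k * a (n - k)) \<le> (\<Sum>k\<le>n. D * a n * (a k + a (n - k)))"
      by (intro sum_mono split_term) auto
    also have "\<dots> = D * a n * ((\<Sum>k\<le>n. a k) + (\<Sum>k\<le>n. a (n - k)))"
      by (simp add: sum_distrib_left sum.distrib distrib_left)
    also have "(\<Sum>k\<le>n. a (n - k)) = (\<Sum>k\<le>n. a k)"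
      by (rule sum.reindex_bij_witness[of _ "\<lambda>k. n - k" "\<lambda>k. n - k"]) auto
    also have "D * a n * ((\<Sum>k\<le>n. a k) + (\<Sum>k\<le>n. a k)) \<le> D * a n * (suminf a + suminf a)"
      using D a suma by (intro mult_left_mono add_mono) (auto simp: less_imp_le)
    finally show "(\<Sum>k\<le>n. (real k + 1) powr (- 3 / 2) * (real (n - k) + 1) powr (- 3 / 2)) \<le> 2 * D * (suminf a) * (real n + 1) powr (- 3 / 2)"
      unfolding a_def[symmetric] by (simp add: mult_ac)
  qed
qed

context infinite_transitive_graph
begin

lemma ball_mono: "m \<le> n \<Longrightarrow> ball m x \<subseteq> ball n x"
proof (induction rule: dec_induct)
  case (step n)
  then show ?case by (auto simp: ball_Suc)
qed simp

lemma ball_nbr: "w \<in> E `` {u} \<Longrightarrow> ball n w \<subseteq> ball (Suc n) u"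
  by (auto simp: ball_Suc)

text \<open>
  The total weight under \<open>q\<close> of the paths of length \<open>n\<close> from \<open>u\<close> to \<open>v\<close> all of whose vertices lie in \<open>A\<close>.
\<close>

primrec confined :: "'v set \<Rightarrow> nat \<Rightarrow> 'v \<Rightarrow> 'v \<Rightarrow> real" where
  "confined A 0 u v = of_bool (u = v \<and> u \<in> A)"
| "confined A (Suc n) u v = of_bool (u \<in> A) * (\<Sum>w\<in>E `` {u}. q u w * confined A n w v)"

text \<open>
  The same as \<open>confined\<close>, except that the last vertex may lie outside \<open>A\<close>.
\<close>

primrec confined_before :: "'v set \<Rightarrow> nat \<Rightarrow> 'v \<Rightarrow> 'v \<Rightarrow> real" where
  "confined_before A 0 u v = of_bool (u = v)"
| "confined_before A (Suc n) u v = of_bool (u \<in> A) * (\<Sum>w\<in>E `` {u}. q u w * confined_before A n w v)"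

definition strictly_below :: "'v \<Rightarrow> 'v set" where "strictly_below y = {w. h y w < 0}"
definition below :: "'v \<Rightarrow> 'v set" where "below y = {w. h y w \<le> 0}"

lemma confined_nonneg: "0 \<le> confined A n u v"
  by (induction n arbitrary: u) (auto intro!: sum_nonneg mult_nonneg_nonneg less_imp_le[OF q_pos])

lemma confined_before_le: "v \<in> A \<Longrightarrow> B \<subseteq> A \<Longrightarrow> confined_before B n u v \<le> confined A n u v"
proof (induction n arbitrary: u)
  case (Suc n)
  have "(\<Sum>w\<in>E `` {u}. q u w * confined_before B n w v) \<le> (\<Sum>w\<in>E `` {u}. q u w * confined A n w v)"
    using Suc by (intro sum_mono mult_left_mono less_imp_le[OF q_pos]) auto
  moreover have "0 \<le> (\<Sum>w\<in>E `` {u}. q u w * confined A n w v)"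
    by (intro sum_nonneg mult_nonneg_nonneg confined_nonneg less_imp_le[OF q_pos])
  ultimately show ?case using Suc.prems by auto
qed auto

lemma sum_nbrs_image:
  assumes "g \<in> \<Gamma>" shows "(\<Sum>w\<in>E `` {g u}. f w) = (\<Sum>w\<in>E `` {u}. f (g w) :: real)"
  unfolding nbrs_image[OF assms] using bij_in[OF assms]
  by (subst sum.reindex) (auto simp: bij_is_inj inj_on_subset[of g UNIV])

lemma confined_invariant: "g \<in> \<Gamma> \<Longrightarrow> confined (g ` A) n (g u) (g v) = confined A n u v"
  by (induction n arbitrary: u) (auto simp: sum_nbrs_image q_invariant inj_in image_iff)

lemma confined_before_invariant: "g \<in> \<Gamma> \<Longrightarrow> confined_before (g ` A) n (g u) (g v) = confined_before A n u v"
  by (induction n arbitrary: u) (auto simp: sum_nbrs_image q_invariant inj_in image_iff)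

lemma strictly_below_image: "g \<in> \<Gamma> \<Longrightarrow> strictly_below (g y) = g ` strictly_below y" and below_image: "g \<in> \<Gamma> \<Longrightarrow> below (g y) = g ` below y"
proof -
  assume g: "g \<in> \<Gamma>"
  have *: "h (g y) w = h y (inv_into UNIV g w)" for w
    using h_invariant[OF g, of y "inv_into UNIV g w"] g by simp
  show "strictly_below (g y) = g ` strictly_below y" "below (g y) = g ` below y"
    unfolding strictly_below_def below_def using g
    by (auto simp: h_invariant * intro!: image_eqI[of _ g "inv_into UNIV g _"])
qed

text \<open>
  Every path has a unique first vertex \<open>y\<close> of maximal height: before it the path is strictly below \<open>y\<close>,
  after it not above \<open>y\<close>. The sets \<open>A\<close> are arbitrary lower sets because the induction on the length of the path applies
  the claim both to \<open>A\<close> and to the set of vertices not above the starting vertex: the first vertex \<open>u\<close> is the first maximum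
  exactly if the rest of the path stays in the latter.
\<close>

lemma first_maximum_decomposition:
  assumes "\<And>x y. x \<in> A \<Longrightarrow> h x y \<le> 0 \<Longrightarrow> y \<in> A" "finite Y" "ball n u \<subseteq> Y"
  shows "confined A n u v = (\<Sum>k\<le>n. \<Sum>y\<in>Y \<inter> A. confined_before (strictly_below y) k u y * confined (below y) (n - k) y v)"
  using assms
proof (induction n arbitrary: u A)
  case 0
  have "u \<in> Y" using 0 center_in_ball by blast
  have "(\<Sum>y\<in>Y \<inter> A. of_bool (u = y) * confined (below y) 0 y v) = (\<Sum>y\<in>Y \<inter> A. if u = y then confined (below u) 0 u v else 0)"
    by (intro sum.cong) auto
  also have "\<dots> = of_bool (u \<in> A) * confined (below u) 0 u v" using 0 \<open>u \<in> Y\<close> by (subst sum.delta') auto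
  finally show ?case by (auto simp: below_def)
next
  case (Suc n)
  have uY: "u \<in> Y" using Suc.prems center_in_ball by blast
  have wY: "ball n w \<subseteq> Y" if "w \<in> E `` {u}" for w using ball_nbr[OF that] Suc.prems by blast
  \<comment> \<open>The right-hand side of the induction hypothesis, with the first maximum restricted to \<open>S\<close>.\<close>
  define G where "G w S = (\<Sum>k\<le>n. \<Sum>y\<in>S. confined_before (strictly_below y) k w y * confined (below y) (n - k) y v)" for w S
  have IH: "confined B n w v = G w (Y \<inter> B)" if "w \<in> E `` {u}" "\<And>x y. x \<in> B \<Longrightarrow> h x y \<le> 0 \<Longrightarrow> y \<in> B" for w B
    unfolding G_def by (rule Suc.IH) (use that Suc.prems wY in auto)
  have below_lower: "y \<in> below z" if "x \<in> below z" "h x y \<le> 0" for x y z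
    using that h_cocycle[of z x y] unfolding below_def by simp
  have "(\<Sum>k\<le>Suc n. \<Sum>y\<in>Y \<inter> A. confined_before (strictly_below y) k u y * confined (below y) (Suc n - k) y v) =
      (\<Sum>y\<in>Y \<inter> A. of_bool (u = y) * confined (below y) (Suc n) y v) +
      (\<Sum>k\<le>n. \<Sum>y\<in>Y \<inter> A. confined_before (strictly_below y) (Suc k) u y * confined (below y) (n - k) y v)"
    by (subst sum.atMost_Suc_shift) simp
  also have "(\<Sum>y\<in>Y \<inter> A. of_bool (u = y) * confined (below y) (Suc n) y v) = of_bool (u \<in> A) * (\<Sum>w\<in>E `` {u}. q u w * G w (Y \<inter> below u))"
  proof -
    have "(\<Sum>y\<in>Y \<inter> A. of_bool (u = y) * confined (below y) (Suc n) y v) = (\<Sum>y\<in>Y \<inter> A. if u = y then confined (below u) (Suc n) u v else 0)"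
      by (intro sum.cong) auto
    also have "\<dots> = of_bool (u \<in> A) * confined (below u) (Suc n) u v" using Suc.prems uY by (subst sum.delta') auto
    also have "confined (below u) (Suc n) u v = (\<Sum>w\<in>E `` {u}. q u w * G w (Y \<inter> below u))"
      using IH[of _ "below u"] below_lower by (simp add: below_def)
    finally show ?thesis .
  qed
  also have "(\<Sum>k\<le>n. \<Sum>y\<in>Y \<inter> A. confined_before (strictly_below y) (Suc k) u y * confined (below y) (n - k) y v) =
      of_bool (u \<in> A) * (\<Sum>w\<in>E `` {u}. q u w * G w (Y \<inter> A - below u))"
  proof -
    \<comment> \<open>If \<open>u\<close> is not the first maximum \<open>y\<close>, then \<open>u\<close> lies strictly below \<open>y\<close>.\<close>
    have strictly_below_iff: "u \<in> strictly_below y \<longleftrightarrow> y \<notin> below u" for y unfolding strictly_below_def below_def using h_swap[of u y] by auto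
    have "(\<Sum>y\<in>Y \<inter> A. confined_before (strictly_below y) (Suc k) u y * confined (below y) (n - k) y v) =
        of_bool (u \<in> A) * (\<Sum>w\<in>E `` {u}. \<Sum>y\<in>Y \<inter> A - below u. q u w * (confined_before (strictly_below y) k w y * confined (below y) (n - k) y v))" for k
    proof -
      have "(\<Sum>y\<in>Y \<inter> A. confined_before (strictly_below y) (Suc k) u y * confined (below y) (n - k) y v) =
          (\<Sum>y\<in>Y \<inter> A - below u. confined_before (strictly_below y) (Suc k) u y * confined (below y) (n - k) y v)"
        by (rule sum.mono_neutral_right) (use Suc.prems strictly_below_iff in auto)
      also have "\<dots> = (\<Sum>y\<in>Y \<inter> A - below u. of_bool (u \<in> A) * (\<Sum>w\<in>E `` {u}. q u w * (confined_before (strictly_below y) k w y * confined (below y) (n - k) y v)))"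
      proof (rule sum.cong)
        fix y assume y: "y \<in> Y \<inter> A - below u"
        then have "u \<in> strictly_below y" using strictly_below_iff by auto
        moreover from this have "u \<in> A" using Suc.prems(1)[of y u] y by (auto simp: strictly_below_def)
        ultimately show "confined_before (strictly_below y) (Suc k) u y * confined (below y) (n - k) y v =
            of_bool (u \<in> A) * (\<Sum>w\<in>E `` {u}. q u w * (confined_before (strictly_below y) k w y * confined (below y) (n - k) y v))"
          by (simp add: sum_distrib_right mult.assoc)
      qed simp
      finally show ?thesis by (simp add: sum_distrib_left[symmetric] sum.swap[of _ "E `` {u}"])
    qed
    then have "(\<Sum>k\<le>n. \<Sum>y\<in>Y \<inter> A. confined_before (strictly_below y) (Suc k) u y * confined (below y) (n - k) y v) =
        of_bool (u \<in> A) * (\<Sum>k\<le>n. \<Sum>w\<in>E `` {u}. \<Sum>y\<in>Y \<inter> A - below u. q u w * (confined_before (strictly_below y) k w y * confined (below y) (n - k) y v))"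
      by (simp only: sum_distrib_left[symmetric])
    also have "(\<Sum>k\<le>n. \<Sum>w\<in>E `` {u}. \<Sum>y\<in>Y \<inter> A - below u. q u w * (confined_before (strictly_below y) k w y * confined (below y) (n - k) y v)) =
        (\<Sum>w\<in>E `` {u}. q u w * G w (Y \<inter> A - below u))"
      unfolding G_def by (subst sum.swap) (simp only: sum_distrib_left[symmetric])
    finally show ?thesis .
  qed
  also have "of_bool (u \<in> A) * (\<Sum>w\<in>E `` {u}. q u w * G w (Y \<inter> below u)) +
      of_bool (u \<in> A) * (\<Sum>w\<in>E `` {u}. q u w * G w (Y \<inter> A - below u)) = confined A (Suc n) u v"
  proof (cases "u \<in> A")
    case True
    then have sub: "below u \<subseteq> A" using Suc.prems(1) by (auto simp: below_def)
    have "G w (Y \<inter> below u) + G w (Y \<inter> A - below u) = G w (Y \<inter> A)" for w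
    proof -
      have "(\<Sum>y\<in>Y \<inter> A. f y) = (\<Sum>y\<in>Y \<inter> below u. f y) + (\<Sum>y\<in>Y \<inter> A - below u. f y)" for f :: "'v \<Rightarrow> real"
        using sub Suc.prems(2) by (subst sum.union_disjoint[symmetric]) (auto intro: sum.cong)
      then show ?thesis unfolding G_def sum.distrib[symmetric] by simp
    qed
    then have "(\<Sum>w\<in>E `` {u}. q u w * G w (Y \<inter> below u)) + (\<Sum>w\<in>E `` {u}. q u w * G w (Y \<inter> A - below u)) =
        (\<Sum>w\<in>E `` {u}. q u w * G w (Y \<inter> A))"
      unfolding sum.distrib[symmetric] distrib_left[symmetric] by simp
    also have "\<dots> = (\<Sum>w\<in>E `` {u}. q u w * confined A n w v)"
      using Suc.prems(1) by (intro sum.cong) (auto simp: IH[of _ A])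
    finally show ?thesis using True by simp
  qed simp
  finally show ?case ..
qed

end

locale nonunimodular_graph = infinite_transitive_graph E \<Gamma> v0
  for E :: "'v rel" and \<Gamma> v0 +
  assumes h_nontrivial: "\<exists>x y. h x y \<noteq> 0"
begin

text \<open>
  By the cocycle identity a height that vanishes on edges vanishes on all pairs.
\<close>

lemma ex_nbr_h_nonzero: "\<exists>w\<in>E `` {v0}. h v0 w \<noteq> 0"
proof (rule ccontr)
  assume "\<not> ?thesis"
  then have v0: "h v0 w = 0" if "(v0, w) \<in> E" for w using that by auto
  have edge: "h x y = 0" if xy: "(x, y) \<in> E" for x y
  proof -
    obtain g where g: "g \<in> \<Gamma>" "g x = v0" using transitive by blast
    then have "(v0, g y) \<in> E" using edge_iff[OF g(1), of x y] xy by simp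
    then show ?thesis using v0 h_invariant[OF g(1), of x y] g by simp
  qed
  have "h x y = 0" for x y
    using connected[of x y]
  proof induction
    case (step y z)
    then show ?case using edge[of y z] h_cocycle[of x y z] by simp
  qed simp
  then show False using h_nontrivial by auto
qed

definition step_bound :: real where "step_bound = (\<Sum>w\<in>E `` {v0}. \<bar>h v0 w\<bar>)"

sublocale walk: symmetric_walk "E `` {v0}" "q v0" "h v0" step_bound
proof
  show "finite (E `` {v0})" by (rule finite_nbrs)
  show "sum (q v0) (E `` {v0}) = 1" by (rule q_sum)
  show "(\<Sum>i\<in>E `` {v0}. q v0 i * f (h v0 i)) = (\<Sum>i\<in>E `` {v0}. q v0 i * f (- h v0 i))" for f
    by (rule q_symmetric_law)
  show "\<exists>i\<in>E `` {v0}. 0 < q v0 i \<and> h v0 i \<noteq> 0" using ex_nbr_h_nonzero q_pos by blast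
  fix i assume "i \<in> E `` {v0}"
  then show "0 \<le> q v0 i" "\<bar>h v0 i\<bar> \<le> step_bound"
    unfolding step_bound_def using less_imp_le[OF q_pos] finite_nbrs
    by (auto intro: member_le_sum[of i "E `` {v0}" "\<lambda>w. \<bar>h v0 w\<bar>"])
qed

text \<open>
  Under \<open>q\<close> the heights perform the walk on the line whose steps are the heights of the neighbours of \<open>v0\<close>.
\<close>

lemma sum_confined_height:
  assumes "finite Y" "ball n u \<subseteq> Y"
  shows "(\<Sum>v\<in>Y. confined (below v0) n u v * F (h v0 v)) = walk.killed n F (h v0 u)"
  using assms
proof (induction n arbitrary: u)
  case 0
  have "u \<in> Y" using 0 center_in_ball by blast
  have "(\<Sum>v\<in>Y. confined (below v0) 0 u v * F (h v0 v)) = (\<Sum>v\<in>Y. if u = v then of_bool (u \<in> below v0) * F (h v0 u) else 0)"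
    by (intro sum.cong) auto
  also have "\<dots> = of_bool (u \<in> below v0) * F (h v0 u)" using 0 \<open>u \<in> Y\<close> by (subst sum.delta') auto
  finally show ?case by (simp add: on_nonpos_def below_def)
next
  case (Suc n)
  have "(\<Sum>v\<in>Y. confined (below v0) (Suc n) u v * F (h v0 v)) =
      of_bool (u \<in> below v0) * (\<Sum>w\<in>E `` {u}. q u w * (\<Sum>v\<in>Y. confined (below v0) n w v * F (h v0 v)))"
    by (simp add: sum_distrib_left sum_distrib_right mult_ac sum.swap[of _ Y])
  also have "(\<Sum>w\<in>E `` {u}. q u w * (\<Sum>v\<in>Y. confined (below v0) n w v * F (h v0 v))) =
      (\<Sum>w\<in>E `` {u}. q u w * walk.killed n F (h v0 u + h u w))"
  proof (rule sum.cong)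
    fix w assume w: "w \<in> E `` {u}"
    then have "(\<Sum>v\<in>Y. confined (below v0) n w v * F (h v0 v)) = walk.killed n F (h v0 w)"
      using Suc.prems ball_nbr[OF w] by (intro Suc.IH) auto
    then show "q u w * (\<Sum>v\<in>Y. confined (below v0) n w v * F (h v0 v)) = q u w * walk.killed n F (h v0 u + h u w)"
      by (simp add: h_cocycle)
  qed simp
  also have "\<dots> = (\<Sum>w\<in>E `` {v0}. q v0 w * walk.killed n F (h v0 u + h v0 w))"
    by (rule sum_nbrs_invariant) (simp add: q_invariant h_invariant)
  also have "\<dots> = walk.avg (walk.killed n F) (h v0 u)" by (simp add: walk.avg_def)
  finally show ?case by (simp add: on_nonpos_def below_def)
qed

text \<open>
  Decompose a loop at \<open>v0\<close> at its first vertex \<open>y\<close> of maximal height and apply mass transport, which exchanges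
  the roles of \<open>y\<close> and \<open>v0\<close>: a path of length \<open>k\<close> from \<open>y\<close> to \<open>v0\<close> and one of length \<open>n - k\<close> from \<open>v0\<close>
  to \<open>y\<close>, neither rising above \<open>v0\<close>, with the additional factor \<open>exp (h v0 y)\<close>. As \<open>h v0 y\<close> is nonpositive, this factor keeps
  \<open>y\<close> at bounded depth in effect, and both paths are confined excursions between bounded heights.
\<close>

theorem weighted_loops_bound:
  obtains C where "C > 0" "\<And>n. confined UNIV n v0 v0 \<le> C * (real n + 1) powr (- 3 / 2)"
proof -
  obtain C1 where C1: "C1 > 0" "\<And>n z x. walk.killed n (window z (z + step_bound)) x \<le>
      C1 * (1 + \<bar>x\<bar>) * (1 + \<bar>z\<bar>) * (real n + 1) powr (- 3 / 2)"
    by (rule walk.killed_window_bound) blast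
  obtain C2 where C2: "C2 > 0" "\<And>n. walk.killed n (\<lambda>y. exp y * (1 + \<bar>y\<bar>)) 0 \<le> C2 * (real n + 1) powr (- 3 / 2)"
    by (rule walk.killed_exp_bound) blast
  obtain C3 :: real where C3: "C3 > 0"
    "\<And>n. (\<Sum>k\<le>n. (real k + 1) powr (- 3 / 2) * (real (n - k) + 1) powr (- 3 / 2)) \<le> C3 * (real n + 1) powr (- 3 / 2)"
    by (rule convolution_bound) blast
  have confined_before_bound: "confined_before (strictly_below v0) k y v0 \<le> C1 * (real k + 1) powr (- 3 / 2) * (1 + \<bar>h v0 y\<bar>)" for k y
  proof -
    have "confined_before (strictly_below v0) k y v0 \<le> confined (below v0) k y v0" by (rule confined_before_le) (auto simp: below_def strictly_below_def)
    also have "\<dots> = confined (below v0) k y v0 * window 0 (0 + step_bound) (h v0 v0)"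
      using walk.L_pos by (simp add: window_def)
    also have "\<dots> \<le> (\<Sum>v\<in>insert v0 (ball k y). confined (below v0) k y v * window 0 (0 + step_bound) (h v0 v))"
      by (rule member_le_sum) (auto simp: finite_ball confined_nonneg window_def)
    also have "\<dots> = walk.killed k (window 0 (0 + step_bound)) (h v0 y)"
      by (rule sum_confined_height) (auto simp: finite_ball)
    also have "\<dots> \<le> C1 * (1 + \<bar>h v0 y\<bar>) * (1 + \<bar>0\<bar>) * (real k + 1) powr (- 3 / 2)" by (rule C1(2))
    finally show ?thesis by (simp add: mult_ac)
  qed
  show ?thesis
  proof (rule that)
    show "C1 * C2 * C3 > 0" using C1 C2 C3 by simp
    fix n
    have "confined UNIV n v0 v0 = (\<Sum>k\<le>n. \<Sum>y\<in>ball n v0 \<inter> UNIV. confined_before (strictly_below y) k v0 y * confined (below y) (n - k) y v0)"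
      by (rule first_maximum_decomposition) (auto simp: finite_ball)
    also have "\<dots> = (\<Sum>k\<le>n. \<Sum>y\<in>ball n v0. confined_before (strictly_below v0) k y v0 * confined (below v0) (n - k) v0 y * exp (h v0 y))"
    proof (rule sum.cong)
      fix k
      show "(\<Sum>y\<in>ball n v0 \<inter> UNIV. confined_before (strictly_below y) k v0 y * confined (below y) (n - k) y v0) =
          (\<Sum>y\<in>ball n v0. confined_before (strictly_below v0) k y v0 * confined (below v0) (n - k) v0 y * exp (h v0 y))"
        using mass_transport[of "\<lambda>x y. confined_before (strictly_below y) k x y * confined (below y) (n - k) y x" v0 n]
        by (simp add: strictly_below_image below_image confined_before_invariant confined_invariant)
    qed simp
    also have "\<dots> \<le> (\<Sum>k\<le>n. C1 * (real k + 1) powr (- 3 / 2) * (C2 * (real (n - k) + 1) powr (- 3 / 2)))"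
    proof (rule sum_mono)
      fix k assume k: "k \<in> {..n}"
      have "(\<Sum>y\<in>ball n v0. confined_before (strictly_below v0) k y v0 * confined (below v0) (n - k) v0 y * exp (h v0 y)) \<le>
          (\<Sum>y\<in>ball n v0. C1 * (real k + 1) powr (- 3 / 2) * (1 + \<bar>h v0 y\<bar>) * confined (below v0) (n - k) v0 y * exp (h v0 y))"
        by (intro sum_mono mult_right_mono confined_before_bound confined_nonneg) auto
      also have "\<dots> = C1 * (real k + 1) powr (- 3 / 2) *
          (\<Sum>y\<in>ball n v0. confined (below v0) (n - k) v0 y * (exp (h v0 y) * (1 + \<bar>h v0 y\<bar>)))"
        unfolding sum_distrib_left by (simp only: mult_ac)
      also have "(\<Sum>y\<in>ball n v0. confined (below v0) (n - k) v0 y * (exp (h v0 y) * (1 + \<bar>h v0 y\<bar>))) =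
          walk.killed (n - k) (\<lambda>y. exp y * (1 + \<bar>y\<bar>)) (h v0 v0)"
        by (rule sum_confined_height) (auto simp: finite_ball intro: ball_mono[THEN subsetD, rotated])
      also have "C1 * (real k + 1) powr (- 3 / 2) * \<dots> \<le>
          C1 * (real k + 1) powr (- 3 / 2) * (C2 * (real (n - k) + 1) powr (- 3 / 2))"
        using C1(1) C2(2)[of "n - k"] by (intro mult_left_mono) auto
      finally show "(\<Sum>y\<in>ball n v0. confined_before (strictly_below v0) k y v0 * confined (below v0) (n - k) v0 y * exp (h v0 y)) \<le>
          C1 * (real k + 1) powr (- 3 / 2) * (C2 * (real (n - k) + 1) powr (- 3 / 2))" .
    qed
    also have "\<dots> = C1 * C2 * (\<Sum>k\<le>n. (real k + 1) powr (- 3 / 2) * (real (n - k) + 1) powr (- 3 / 2))"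
      unfolding sum_distrib_left by (simp only: mult_ac)
    also have "\<dots> \<le> C1 * C2 * (C3 * (real n + 1) powr (- 3 / 2))"
      using C1(1) C2(1) by (intro mult_left_mono C3) auto
    finally show "confined UNIV n v0 v0 \<le> C1 * C2 * C3 * (real n + 1) powr (- 3 / 2)" by (simp add: mult_ac)
  qed
qed

end

section \<open>Amenability and the growth of return probabilities\<close>

definition bdd :: "('a \<Rightarrow> real) \<Rightarrow> bool" where "bdd f \<longleftrightarrow> (\<exists>C. \<forall>x. \<bar>f x\<bar> \<le> C)"

lemma bdd_const: "bdd (\<lambda>_. c)" and bdd_cmult: "bdd f \<Longrightarrow> bdd (\<lambda>x. c * f x)"
  and bdd_add: "bdd f \<Longrightarrow> bdd g \<Longrightarrow> bdd (\<lambda>x. f x + g x)"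
proof -
  show "bdd (\<lambda>_. c)" unfolding bdd_def by blast
  show "bdd (\<lambda>x. c * f x)" if "bdd f"
  proof -
    obtain C where "\<And>x. \<bar>f x\<bar> \<le> C" using \<open>bdd f\<close> unfolding bdd_def by blast
    then have "\<bar>c * f x\<bar> \<le> \<bar>c\<bar> * C" for x by (simp add: abs_mult mult_left_mono)
    then show ?thesis unfolding bdd_def by blast
  qed
  show "bdd (\<lambda>x. f x + g x)" if "bdd f" "bdd g"
  proof -
    obtain C D where "\<And>x. \<bar>f x\<bar> \<le> C" "\<And>x. \<bar>g x\<bar> \<le> D" using \<open>bdd f\<close> \<open>bdd g\<close> unfolding bdd_def by blast
    then have "\<bar>f x + g x\<bar> \<le> C + D" for x by (meson abs_triangle_ineq add_mono order_trans)
    then show ?thesis unfolding bdd_def by blast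
  qed
qed

text \<open>
  An invariant mean of bounded functions on the vertices. In contrast to a mean on the group it involves no measurability.
\<close>

definition vertex_mean :: "('v \<Rightarrow> 'v) set \<Rightarrow> (('v \<Rightarrow> real) \<Rightarrow> real) \<Rightarrow> bool" where
  "vertex_mean \<Gamma> m \<longleftrightarrow>
     (\<forall>f g. bdd f \<longrightarrow> bdd g \<longrightarrow> m (\<lambda>x. f x + g x) = m f + m g) \<and>
     (\<forall>c f. bdd f \<longrightarrow> m (\<lambda>x. c * f x) = c * m f) \<and>
     m (\<lambda>_. 1) = 1 \<and>
     (\<forall>f. bdd f \<longrightarrow> (\<forall>x. 0 \<le> f x) \<longrightarrow> 0 \<le> m f) \<and>
     (\<forall>\<gamma>\<in>\<Gamma>. \<forall>f. bdd f \<longrightarrow> m (\<lambda>x. f (\<gamma> x)) = m f)"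

lemma vertex_meanD:
  assumes "vertex_mean \<Gamma> m"
  shows vertex_mean_add: "bdd f \<Longrightarrow> bdd g \<Longrightarrow> m (\<lambda>x. f x + g x) = m f + m g"
    and vertex_mean_cmult: "bdd f \<Longrightarrow> m (\<lambda>x. c * f x) = c * m f"
    and vertex_mean_one: "m (\<lambda>_. 1) = 1"
    and vertex_mean_nonneg: "bdd f \<Longrightarrow> (\<And>x. 0 \<le> f x) \<Longrightarrow> 0 \<le> m f"
    and vertex_mean_invariant: "\<gamma> \<in> \<Gamma> \<Longrightarrow> bdd f \<Longrightarrow> m (\<lambda>x. f (\<gamma> x)) = m f"
  using assms unfolding vertex_mean_def by simp_all

lemma vertex_mean_sum:
  assumes m: "vertex_mean \<Gamma> m" and "finite Z" and "\<And>z. z \<in> Z \<Longrightarrow> bdd (f z)"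
  shows "bdd (\<lambda>x. \<Sum>z\<in>Z. c z * f z x) \<and> m (\<lambda>x. \<Sum>z\<in>Z. c z * f z x) = (\<Sum>z\<in>Z. c z * m (f z))"
  using assms(2,3)
proof (induction Z rule: finite_induct)
  case empty
  have "m (\<lambda>x. 0 * 1) = 0 * m (\<lambda>_. 1)"
    by (rule vertex_mean_cmult[OF m bdd_const])
  then show ?case by (simp add: bdd_const)
next
  case (insert z Z)
  then have IH: "bdd (\<lambda>x. \<Sum>z\<in>Z. c z * f z x)" "m (\<lambda>x. \<Sum>z\<in>Z. c z * f z x) = (\<Sum>z\<in>Z. c z * m (f z))"
    and z: "bdd (f z)" by auto
  have "m (\<lambda>x. c z * f z x + (\<Sum>z\<in>Z. c z * f z x)) = m (\<lambda>x. c z * f z x) + m (\<lambda>x. \<Sum>z\<in>Z. c z * f z x)"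
    by (rule vertex_mean_add[OF m bdd_cmult[OF z] IH(1)])
  moreover have "m (\<lambda>x. c z * f z x) = c z * m (f z)" by (rule vertex_mean_cmult[OF m z])
  ultimately show ?case using insert.hyps IH bdd_add[OF bdd_cmult[OF z] IH(1)] by simp
qed

lemma vertex_mean_le:
  assumes m: "vertex_mean \<Gamma> m" and f: "bdd f" "\<And>x. f x \<le> C"
  shows "m f \<le> C"
proof -
  have c1: "bdd (\<lambda>_. C * 1)" and c2: "bdd (\<lambda>x. - 1 * f x)" using bdd_const bdd_cmult[OF f(1)] by blast+
  have "0 \<le> m (\<lambda>x. C * 1 + - 1 * f x)"
    by (rule vertex_mean_nonneg[OF m bdd_add[OF c1 c2]]) (use f(2) in simp)
  also have "m (\<lambda>x. C * 1 + - 1 * f x) = m (\<lambda>x. C * 1) + m (\<lambda>x. - 1 * f x)"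
    by (rule vertex_mean_add[OF m c1 c2])
  also have "m (\<lambda>x. C * 1) = C * m (\<lambda>_. 1)" by (rule vertex_mean_cmult[OF m bdd_const])
  also have "m (\<lambda>x. - 1 * f x) = - 1 * m f" by (rule vertex_mean_cmult[OF m f(1)])
  also have "m (\<lambda>_. 1) = 1" by (rule vertex_mean_one[OF m])
  finally show ?thesis by simp
qed

text \<open>
  The definition of the walk appends its last step; the kernels above split off the first one.
\<close>

lemma srw_Suc_first_step: "srw E x (Suc n) = bind_pmf (pmf_of_set (E `` {x})) (\<lambda>y. srw E y n)"
proof (induction n)
  case 0
  show ?case by (simp add: bind_return_pmf bind_return_pmf')
next
  case (Suc n)
  have "srw E x (Suc (Suc n)) = bind_pmf (srw E x (Suc n)) (\<lambda>y. pmf_of_set (E `` {y}))" by simp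
  also have "\<dots> = bind_pmf (pmf_of_set (E `` {x})) (\<lambda>y. bind_pmf (srw E y n) (\<lambda>y. pmf_of_set (E `` {y})))"
    unfolding Suc.IH bind_assoc_pmf ..
  finally show ?case by simp
qed

context infinite_transitive_graph
begin

abbreviation step_prob :: "nat \<Rightarrow> 'v \<Rightarrow> 'v \<Rightarrow> real" where "step_prob n x y \<equiv> pmf (srw E x n) y"

lemma nbrs_ne: "E `` {x} \<noteq> {}"
  using card_nbrs[of x] deg_pos by auto

lemma step_prob_0: "step_prob 0 x y = of_bool (x = y)"
  by (simp add: pmf_return indicator_def)

lemma step_prob_Suc: "step_prob (Suc n) x y = (\<Sum>z\<in>E `` {x}. step_prob n z y) / deg"
  unfolding srw_Suc_first_step using nbrs_ne[of x] finite_nbrs[of x]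
  by (simp add: pmf_bind_pmf_of_set card_nbrs)

lemma step_prob_invariant: "g \<in> \<Gamma> \<Longrightarrow> step_prob n (g x) (g y) = step_prob n x y"
proof (induction n arbitrary: x)
  case 0
  then show ?case unfolding step_prob_0 by (simp add: inj_in)
next
  case (Suc n)
  then show ?case unfolding step_prob_Suc by (simp add: sum_nbrs_image)
qed

lemma return_prob_eq: "return_prob E x n = return_prob E v0 n"
proof -
  obtain g where "g \<in> \<Gamma>" "g v0 = x" using transitive by blast
  then show ?thesis unfolding return_prob_def using step_prob_invariant[where g = g and n = n and x = v0 and y = v0] by simp
qed

text \<open>
  By the cocycle identity the tilting factors along a path from \<open>u\<close> to \<open>v\<close> multiply to \<open>exp (h u v / 2)\<close>.
\<close>

lemma confined_UNIV_eq: "confined UNIV n u v = step_prob n u v * exp (h u v / 2) / lam ^ n"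
proof (induction n arbitrary: u)
  case 0
  show ?case unfolding step_prob_0 by auto
next
  case (Suc n)
  have "confined UNIV (Suc n) u v = (\<Sum>w\<in>E `` {u}. step_prob n w v * exp (h u v / 2) / (deg * lam ^ Suc n))"
  proof -
    have "q u w * (step_prob n w v * exp (h w v / 2) / lam ^ n) = step_prob n w v * exp (h u v / 2) / (deg * lam ^ Suc n)" for w
    proof -
      have "exp (h u v / 2) = exp (h u w / 2) * exp (h w v / 2)"
        unfolding exp_add[symmetric] h_cocycle[of u w v, symmetric] by (simp add: add_divide_distrib)
      then show ?thesis unfolding q_def by (simp add: mult_ac)
    qed
    then show ?thesis by (simp add: Suc.IH)
  qed
  then show ?case unfolding step_prob_Suc by (simp add: sum_divide_distrib[symmetric] sum_distrib_right[symmetric])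
qed

lemma return_prob_eq_confined: "return_prob E v0 n = confined UNIV n v0 v0 * lam ^ n"
  unfolding confined_UNIV_eq return_prob_def using lam_pos by simp

lemma return_prob_bounds: "0 \<le> return_prob E x n" "return_prob E x n \<le> 1"
  unfolding return_prob_def by (auto intro: pmf_le_1)

lemma eventually_return_prob_less:
  assumes "spectral_radius E x < s"
  shows "0 \<le> spectral_radius E x" "eventually (\<lambda>n. return_prob E x n \<le> s ^ n) sequentially"
proof -
  let ?r = "\<lambda>n. ereal (root n (return_prob E x n))"
  have r01: "0 \<le> ?r n" "?r n \<le> 1" for n
  proof -
    show "0 \<le> ?r n" using return_prob_bounds(1)[of x n] by (cases "n = 0") (auto simp: real_root_ge_zero)
    show "?r n \<le> 1" using return_prob_bounds(2)[of x n] by (cases "n = 0") (auto simp: real_root_le_1_iff)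
  qed
  have "0 \<le> limsup ?r" by (rule le_Limsup) (use r01 in auto)
  moreover have "limsup ?r \<le> 1" by (rule Limsup_bounded) (use r01 in auto)
  ultimately have lim: "limsup ?r = ereal (spectral_radius E x)" "0 \<le> spectral_radius E x"
    unfolding spectral_radius_def by (cases "limsup ?r"; simp)+
  show "0 \<le> spectral_radius E x" by fact
  have "limsup ?r < ereal s" using lim assms by simp
  then have "eventually (\<lambda>n. ?r n < ereal s) sequentially" by (rule Limsup_lessD)
  then show "eventually (\<lambda>n. return_prob E x n \<le> s ^ n) sequentially"
    using eventually_gt_at_top[of 0]
  proof eventually_elim
    case (elim n)
    then have "root n (return_prob E x n) ^ n \<le> s ^ n"
      using return_prob_bounds(1)[of x n] by (intro power_mono) (auto simp: real_root_ge_zero)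
    then show ?case using elim return_prob_bounds(1)[of x n] by simp
  qed
qed

text \<open>
  Suppose \<open>\<rho> < t < lam\<close> for the spectral radius \<open>\<rho>\<close>. The Green function \<open>G y x\<close>, the sum of \<open>p\<^sub>n(y, x) / t ^ n\<close>, is then finite, and its values at
  neighbours \<open>y\<close> are comparable uniformly in \<open>x\<close>, so \<open>ln (G z x / G y x)\<close> is bounded in \<open>x\<close> and has a mean \<open>ell y z\<close>. Invariance of the mean
  makes \<open>ell\<close> an invariant antisymmetric function of edges, whose drift under \<open>q\<close> is \<open>0\<close>. On the other hand
  \<open>G\<close> is superharmonic, and \<open>ln u \<le> u - 1\<close> turns this into the upper bound \<open>ln (t / lam)\<close> for the drift, which is negative.
\<close>

lemma lam_le_spectral_radius:
  assumes m: "vertex_mean \<Gamma> m"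
  shows "lam \<le> spectral_radius E v0"
proof (rule ccontr)
  assume "\<not> ?thesis"
  then have less: "spectral_radius E v0 < lam" by simp
  \<comment> \<open>Two numbers between the radius and \<open>lam\<close>: \<open>s\<close> bounds the return probabilities, and \<open>t > s\<close> makes the Green function converge.\<close>
  define t where "t = (spectral_radius E v0 + lam) / 2"
  define s where "s = (spectral_radius E v0 + t) / 2"
  have st: "spectral_radius E v0 < s" "s < t" "t < lam" unfolding s_def t_def using less by simp_all
  have s: "s > 0" using eventually_return_prob_less(1)[OF st(1)] st by linarith
  then have t: "t > 0" using st by linarith
  define a where "a y x n = step_prob n y x / t ^ n" for y x n
  have a0: "0 \<le> a y x n" for y x n unfolding a_def using t by simp
  have a_nbr: "a z x n \<le> deg * t * a y x (Suc n)" if "(y, z) \<in> E" for x y z n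
  proof -
    have "step_prob n z x \<le> (\<Sum>z\<in>E `` {y}. step_prob n z x)" by (rule member_le_sum) (use that finite_nbrs in auto)
    then have "step_prob n z x \<le> deg * step_prob (Suc n) y x" unfolding step_prob_Suc using deg_pos by simp
    then have "step_prob n z x / t ^ n \<le> deg * step_prob (Suc n) y x / t ^ n" using t by (intro divide_right_mono) auto
    then show ?thesis unfolding a_def using t by simp
  qed
  have sm_diag: "summable (a x x)" for x
  proof (rule summable_comparison_test_ev)
    show "eventually (\<lambda>n. norm (a x x n) \<le> (s / t) ^ n) sequentially"
      using eventually_return_prob_less(2)[OF st(1)]
    proof eventually_elim
      case (elim n)
      then have "step_prob n x x \<le> s ^ n" using return_prob_eq[of x n] unfolding return_prob_def by simp
      then show ?case unfolding a_def using t by (simp add: power_divide divide_right_mono)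
    qed
    show "summable (\<lambda>n. (s / t) ^ n)" using s st t by (intro summable_geometric) simp
  qed
  have sm: "summable (a y x)" for y x
    using connected[of x y]
  proof induction
    case base
    show ?case by (rule sm_diag)
  next
    case (step y z)
    have "summable (\<lambda>n. deg * t * a y x (Suc n))" using step by (intro summable_mult) (simp add: summable_Suc_iff)
    then show ?case by (rule summable_comparison_test') (use a0 a_nbr[OF step(2)] in auto)
  qed
  define G where "G y x = (\<Sum>n. a y x n)" for y x
  have G_Suc: "(\<Sum>n. a y x (Suc n)) \<le> G y x" for y x
    unfolding G_def suminf_split_head[OF sm] using a0[of y x 0] by simp
  have G_nbr: "G z x \<le> deg * t * G y x" if "(y, z) \<in> E" for x y z
  proof -
    have smS: "summable (\<lambda>n. a y x (Suc n))" using sm by (simp add: summable_Suc_iff)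
    have "G z x \<le> (\<Sum>n. deg * t * a y x (Suc n))"
      unfolding G_def by (intro suminf_le a_nbr that sm summable_mult smS)
    also have "\<dots> = deg * t * (\<Sum>n. a y x (Suc n))" by (rule suminf_mult[OF smS])
    also have "\<dots> \<le> deg * t * G y x" using deg_pos t G_Suc by (intro mult_left_mono) auto
    finally show ?thesis .
  qed
  have G_pos: "G y x > 0" for y x
    using connected[of x y]
  proof induction
    case base
    have "a x x 0 \<le> G x x" unfolding G_def using sum_le_suminf[OF sm[of x x], of "{0}"] a0 by simp
    then show ?case by (simp add: a_def step_prob_0)
  next
    case (step y z)
    then have "G y x \<le> deg * t * G z x" using E_sym by (intro G_nbr) (auto dest: symD)
    then have "0 < (deg * t) * G z x" using step by linarith
    moreover have "0 < deg * t" using deg_pos t by simp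
    ultimately show ?case by (rule zero_less_mult_pos)
  qed
  have G_super: "(\<Sum>z\<in>E `` {y}. G z x) \<le> deg * t * G y x" for y x
  proof -
    have "(\<Sum>z\<in>E `` {y}. G z x) = (\<Sum>n. \<Sum>z\<in>E `` {y}. a z x n)"
      unfolding G_def by (rule suminf_sum[symmetric]) (rule sm)
    also have "(\<lambda>n. \<Sum>z\<in>E `` {y}. a z x n) = (\<lambda>n. deg * t * a y x (Suc n))"
      unfolding a_def step_prob_Suc using deg_pos t by (simp add: sum_divide_distrib[symmetric] fun_eq_iff)
    also have "(\<Sum>n. deg * t * a y x (Suc n)) = deg * t * (\<Sum>n. a y x (Suc n))"
      by (rule suminf_mult) (use sm in \<open>simp add: summable_Suc_iff\<close>)
    also have "\<dots> \<le> deg * t * G y x" using deg_pos t G_Suc by (intro mult_left_mono) auto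
    finally show ?thesis .
  qed
  have G_inv: "G (g y) (g x) = G y x" if "g \<in> \<Gamma>" for g y x
    unfolding G_def a_def using that by (simp add: step_prob_invariant)
  define l where "l x y z = ln (G z x / G y x)" for x y z
  have l_bdd: "bdd (\<lambda>x. l x y z)" if yz: "(y, z) \<in> E" for y z
  proof -
    have zy: "(z, y) \<in> E" using yz E_sym by (auto dest: symD)
    have "\<bar>l x y z\<bar> \<le> ln (deg * t)" for x
    proof -
      have "G z x / G y x \<le> deg * t" "1 / (deg * t) \<le> G z x / G y x"
        using G_nbr[OF yz, of x] G_nbr[OF zy, of x] G_pos[of y x] G_pos[of z x] deg_pos t by (simp_all add: field_simps)
      moreover have "0 < G z x / G y x" using G_pos by simp
      ultimately have "ln (G z x / G y x) \<le> ln (deg * t)" "ln (1 / (deg * t)) \<le> ln (G z x / G y x)"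
        using deg_pos t by (simp_all add: ln_mono)
      moreover have "ln (1 / (deg * t)) = - ln (deg * t)" using deg_pos t by (simp add: ln_div)
      ultimately show ?thesis unfolding l_def by linarith
    qed
    then show ?thesis unfolding bdd_def by blast
  qed
  \<comment> \<open>The uniform bound concerns edges, and these are all that matters for the drift; off the edges \<open>ell\<close> is \<open>0\<close>, which keeps it invariant and antisymmetric.\<close>
  define ell where "ell y z = of_bool ((y, z) \<in> E) * m (\<lambda>x. l x y z)" for y z
  have ell_inv: "ell (g y) (g z) = ell y z" if g: "g \<in> \<Gamma>" for g y z
  proof (cases "(y, z) \<in> E")
    case True
    then have "bdd (\<lambda>x. l x (g y) (g z))" using l_bdd edge_iff[OF g] by simp
    then have "m (\<lambda>x. l (g x) (g y) (g z)) = m (\<lambda>x. l x (g y) (g z))"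
      by (rule vertex_mean_invariant[OF m g])
    then show ?thesis unfolding ell_def l_def using g by (simp add: edge_iff G_inv)
  next
    case False
    then show ?thesis unfolding ell_def using edge_iff[OF g] by simp
  qed
  have ell_anti: "ell z y = - ell y z" for y z
  proof (cases "(y, z) \<in> E")
    case True
    have "m (\<lambda>x. - 1 * l x y z) = - 1 * m (\<lambda>x. l x y z)"
      by (rule vertex_mean_cmult[OF m l_bdd[OF True]])
    moreover have "(\<lambda>x. - 1 * l x y z) = (\<lambda>x. l x z y)"
      unfolding l_def using G_pos by (simp add: fun_eq_iff ln_div)
    moreover have "(z, y) \<in> E" using True E_sym by (auto dest: symD)
    ultimately show ?thesis using True unfolding ell_def by simp
  next
    case False
    then have "(z, y) \<notin> E" using E_sym by (auto dest: symD)
    then show ?thesis using False unfolding ell_def by simp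
  qed
  have "(\<Sum>z\<in>E `` {v0}. q v0 z * l x v0 z) \<le> - ln (lam / t)" for x
  proof -
    have "(\<Sum>z\<in>E `` {v0}. q v0 z * l x v0 z) =
        (\<Sum>z\<in>E `` {v0}. q v0 z * l x v0 z) - (\<Sum>z\<in>E `` {v0}. q v0 z * h v0 z) / 2 "
    proof -
      have "(\<Sum>z\<in>E `` {v0}. q v0 z * h v0 z) = 0"
        by (rule q_antisymmetric_sum[of h]) (simp add: h_invariant, rule h_swap)
      then show ?thesis by simp
    qed
    also have "\<dots> = (\<Sum>z\<in>E `` {v0}. q v0 z * (l x v0 z - h v0 z / 2 + ln (lam / t))) - ln (lam / t)"
    proof -
      have "q v0 z * (l x v0 z - h v0 z / 2 + ln (lam / t)) =
          q v0 z * l x v0 z - q v0 z * h v0 z / 2 + q v0 z * ln (lam / t)" for z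
        by (simp only: distrib_left right_diff_distrib times_divide_eq_right)
      then show ?thesis
        by (simp add: sum.distrib sum_subtractf sum_divide_distrib[symmetric] sum_distrib_right[symmetric] q_sum)
    qed
    also have "\<dots> \<le> (\<Sum>z\<in>E `` {v0}. G z x / (deg * t * G v0 x) - q v0 z) - ln (lam / t)"
    proof (intro diff_right_mono sum_mono)
      fix z
      \<comment> \<open>The logarithm of \<open>?u\<close> differs from \<open>l\<close> by the drift-free \<open>h v0 z / 2\<close> and a constant; with this choice \<open>\<Sum>q * ?u\<close> is \<open>\<Sum>G z x / (deg * t * G v0 x)\<close>.\<close>
      let ?u = "G z x / G v0 x * exp (- h v0 z / 2) * (lam / t)"
      have "ln ?u = l x v0 z - h v0 z / 2 + ln (lam / t)"
        unfolding l_def using G_pos lam_pos t by (simp add: ln_mult ln_div less_imp_neq[symmetric])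
      moreover have "ln ?u \<le> ?u - 1" using G_pos lam_pos t by (intro ln_le_minus_one) simp
      ultimately have "q v0 z * (l x v0 z - h v0 z / 2 + ln (lam / t)) \<le> q v0 z * (?u - 1)"
        using q_pos by (intro mult_left_mono) (auto simp: less_imp_le)
      also have "q v0 z * (?u - 1) = G z x / (deg * t * G v0 x) - q v0 z"
      proof -
        have "q v0 z * ?u = (exp (h v0 z / 2) * exp (- h v0 z / 2)) * (G z x / (deg * t * G v0 x))"
          unfolding q_def using lam_pos by (simp add: mult_ac)
        also have "exp (h v0 z / 2) * exp (- h v0 z / 2) = 1" unfolding exp_add[symmetric] by simp
        finally show ?thesis by (simp add: right_diff_distrib)
      qed
      finally show "q v0 z * (l x v0 z - h v0 z / 2 + ln (lam / t)) \<le> G z x / (deg * t * G v0 x) - q v0 z" .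
    qed
    also have "\<dots> = (\<Sum>z\<in>E `` {v0}. G z x) / (deg * t * G v0 x) - 1 - ln (lam / t)"
      by (simp add: sum_subtractf q_sum sum_divide_distrib)
    also have "\<dots> \<le> - ln (lam / t)"
      using G_super[of x v0] G_pos[of v0 x] deg_pos t by (simp add: divide_le_eq)
    finally show ?thesis .
  qed
  moreover have "bdd (\<lambda>x. \<Sum>z\<in>E `` {v0}. q v0 z * l x v0 z) \<and>
      m (\<lambda>x. \<Sum>z\<in>E `` {v0}. q v0 z * l x v0 z) = (\<Sum>z\<in>E `` {v0}. q v0 z * m (\<lambda>x. l x v0 z))"
    by (rule vertex_mean_sum[OF m finite_nbrs]) (simp add: l_bdd)
  ultimately have "(\<Sum>z\<in>E `` {v0}. q v0 z * m (\<lambda>x. l x v0 z)) \<le> - ln (lam / t)"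
    using vertex_mean_le[OF m, of "\<lambda>x. \<Sum>z\<in>E `` {v0}. q v0 z * l x v0 z"] by simp
  moreover have "(\<Sum>z\<in>E `` {v0}. q v0 z * m (\<lambda>x. l x v0 z)) = (\<Sum>z\<in>E `` {v0}. q v0 z * ell v0 z)"
    by (intro sum.cong) (auto simp: ell_def)
  moreover have "(\<Sum>z\<in>E `` {v0}. q v0 z * ell v0 z) = 0"
    by (rule q_antisymmetric_sum[of ell]) (erule ell_inv, rule ell_anti)
  moreover have "ln (lam / t) > 0" using st t by (intro ln_gt_zero) simp
  ultimately show False by linarith
qed

end

section \<open>Haar measure and the modular function\<close>

lemma ennreal_of_nat_mult_cancel:
  assumes "of_nat k * (a::ennreal) = of_nat k * b" "k > 0"
  shows "a = b"
  using assms ennreal_mult_cancel_left[of "of_nat k" a b] by (auto simp: ennreal_of_nat_eq_real_of_nat)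

locale transitive_automorphisms = transitive_graph E \<Gamma> v0
  for E :: "'v rel" and \<Gamma> v0 +
  assumes subset_automorphisms: "\<Gamma> \<subseteq> automorphisms E"
begin

abbreviation "topol \<equiv> subtopology (Aut_topology E) \<Gamma>"
abbreviation "grp \<equiv> (Aut E)\<lparr>carrier := \<Gamma>\<rparr>"

lemma openin_topol: "openin topol W \<longleftrightarrow> (\<exists>O'. openin pointwise_topology O' \<and> W = O' \<inter> \<Gamma>)"
  unfolding Aut_topology_def subtopology_subtopology openin_subtopology
  using subset_automorphisms by (simp add: Int_absorb1)

lemma topspace_topol: "topspace topol = \<Gamma>"
  unfolding Aut_topology_def using subset_automorphisms
  by (auto simp: pointwise_topology_def)

definition cyl :: "('v \<times> 'v) set \<Rightarrow> ('v \<Rightarrow> 'v) set" where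
  "cyl P = {g \<in> \<Gamma>. \<forall>(x, y)\<in>P. g x = y}"

lemma openin_evaluation: "openin topol {g \<in> \<Gamma>. g x \<in> B}"
proof -
  have "openin pointwise_topology {g \<in> topspace (pointwise_topology :: ('v \<Rightarrow> 'v) topology). g x \<in> B}"
    unfolding pointwise_topology_def
    by (rule openin_continuous_map_preimage[of _ "discrete_topology UNIV"])
      (auto intro: continuous_map_product_projection)
  then show ?thesis unfolding openin_topol
    by (intro exI[of _ "{g \<in> topspace (pointwise_topology :: ('v \<Rightarrow> 'v) topology). g x \<in> B}"])
      (auto simp: pointwise_topology_def)
qed

lemma openin_cyl: "finite P \<Longrightarrow> openin topol (cyl P)"
proof (induction P rule: finite_induct)
  case empty
  show ?case using openin_topspace[of topol] unfolding topspace_topol by (simp add: cyl_def)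
next
  case (insert p P)
  have "cyl (insert p P) = {g \<in> \<Gamma>. g (fst p) \<in> {snd p}} \<inter> cyl P"
    unfolding cyl_def by (cases p) auto
  then show ?case by (simp only:) (intro openin_Int openin_evaluation insert.IH)
qed

lemma cyl_subset_open:
  assumes "openin topol W" "g \<in> W"
  obtains P where "finite P" "g \<in> cyl P" "cyl P \<subseteq> W"
proof -
  obtain O' where O': "openin pointwise_topology O'" "W = O' \<inter> \<Gamma>" using assms openin_topol by auto
  obtain B where B: "finite {i. B i \<noteq> UNIV}" "g \<in> Pi\<^sub>E UNIV B" "Pi\<^sub>E UNIV B \<subseteq> O'"
    using O' assms(2) unfolding pointwise_topology_def openin_product_topology_alt by force
  show ?thesis
  proof (rule that[of "(\<lambda>x. (x, g x)) ` {i. B i \<noteq> UNIV}"])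
    show "g \<in> cyl ((\<lambda>x. (x, g x)) ` {i. B i \<noteq> UNIV})" using assms(2) O' by (auto simp: cyl_def)
    show "cyl ((\<lambda>x. (x, g x)) ` {i. B i \<noteq> UNIV}) \<subseteq> W"
    proof
      fix k assume k: "k \<in> cyl ((\<lambda>x. (x, g x)) ` {i. B i \<noteq> UNIV})"
      have "k i \<in> B i" for i
      proof (cases "B i = UNIV")
        case False
        then have "k i = g i" using k by (auto simp: cyl_def)
        then show ?thesis using B(2) by auto
      qed auto
      then show "k \<in> W" using B(3) O'(2) k by (auto simp: cyl_def)
    qed
  qed (use B in auto)
qed

lemma countable_vertices: "countable (UNIV :: 'v set)"
proof -
  have "(UNIV :: 'v set) = (\<Union>n. ball n v0)" using in_some_ball by auto
  also have "countable \<dots>" by (intro countable_UN countableI_type countable_finite finite_ball)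
  finally show ?thesis .
qed

definition cyls :: "('v \<Rightarrow> 'v) set set" where "cyls = cyl ` {P. finite P}"

lemma countable_cyls: "countable cyls"
proof -
  have "countable {P :: ('v \<times> 'v) set. finite P \<and> P \<subseteq> UNIV \<times> UNIV}"
    by (intro countable_Collect_finite_subset countable_SIGMA countable_vertices)
  then show ?thesis unfolding cyls_def by simp
qed

text \<open>
  There are only countably many cylinders, so they generate the Borel sets and not only the topology.
\<close>

lemma sets_Borel: "sets (Borel_sigma topol) = sigma_sets \<Gamma> cyls"
proof -
  have "{W. openin topol W} \<subseteq> Pow \<Gamma>" using openin_subset topspace_topol by blast
  then have "sets (Borel_sigma topol) = sigma_sets \<Gamma> {W. openin topol W}"
    unfolding Borel_sigma_def topspace_topol by simp
  also have "\<dots> = sigma_sets \<Gamma> cyls"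
  proof (rule sigma_sets_eqI)
    fix W assume "W \<in> {W. openin topol W}"
    then have W: "openin topol W" by simp
    have "W = \<Union> {C \<in> cyls. C \<subseteq> W}"
    proof (intro subset_antisym subsetI)
      fix g assume "g \<in> W"
      then obtain P where "finite P" "g \<in> cyl P" "cyl P \<subseteq> W" by (rule cyl_subset_open[OF W])
      then show "g \<in> \<Union> {C \<in> cyls. C \<subseteq> W}" unfolding cyls_def by auto
    qed auto
    moreover have sub: "cyls \<subseteq> Pow \<Gamma>" unfolding cyls_def cyl_def by auto
    moreover from sub have "\<Union> {C \<in> cyls. C \<subseteq> W} \<in> sets (sigma \<Gamma> cyls)"
    proof (intro sets.countable_Union)
      show "countable {C \<in> cyls. C \<subseteq> W}" by (rule countable_subset[OF _ countable_cyls]) auto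
    qed auto
    ultimately show "W \<in> sigma_sets \<Gamma> cyls" using sets_measure_of[OF sub] by simp
  next
    fix C assume "C \<in> cyls"
    then show "C \<in> sigma_sets \<Gamma> {W. openin topol W}"
      unfolding cyls_def using openin_cyl by auto
  qed
  finally show ?thesis .
qed

definition left_invariant :: "('v \<Rightarrow> 'v) measure \<Rightarrow> bool" where
  "left_invariant M \<longleftrightarrow> sets M = sets (Borel_sigma topol) \<and>
     (\<forall>g\<in>\<Gamma>. \<forall>A\<in>sets M. emeasure M ((\<lambda>a. g \<circ> a) ` A) = emeasure M A)"

lemma left_invariant_space: "sets M = sets (Borel_sigma topol) \<Longrightarrow> space M = \<Gamma>"
proof -
  assume "sets M = sets (Borel_sigma topol)"
  then have "space M = space (Borel_sigma topol)" by (rule sets_eq_imp_space_eq)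
  also have "\<dots> = \<Gamma>" unfolding Borel_sigma_def topspace_topol by (simp add: space_measure_of_conv)
  finally show ?thesis .
qed

lemma open_in_sets: "sets M = sets (Borel_sigma topol) \<Longrightarrow> openin topol W \<Longrightarrow> W \<in> sets M"
proof -
  assume M: "sets M = sets (Borel_sigma topol)" and W: "openin topol W"
  have "{W. openin topol W} \<subseteq> Pow \<Gamma>" using openin_subset topspace_topol by blast
  then have "sets (Borel_sigma topol) = sigma_sets \<Gamma> {W. openin topol W}"
    unfolding Borel_sigma_def topspace_topol by simp
  then show "W \<in> sets M" using M W by auto
qed

lemma stab_eq_cyl: "stab F = cyl ((\<lambda>x. (x, x)) ` F)"
  unfolding stab_def cyl_def by auto

lemma stab_in_sets: "sets M = sets (Borel_sigma topol) \<Longrightarrow> finite F \<Longrightarrow> stab F \<in> sets M"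
  unfolding stab_eq_cyl by (intro open_in_sets openin_cyl) auto

lemma cyl_eq_coset: "e \<in> cyl P \<Longrightarrow> cyl P = (\<lambda>a. e \<circ> a) ` stab (fst ` P)"
proof -
  assume e: "e \<in> cyl P"
  then have e\<Gamma>: "e \<in> \<Gamma>" and eP: "\<And>x y. (x, y) \<in> P \<Longrightarrow> e x = y" by (auto simp: cyl_def)
  have "g \<in> (\<lambda>a. e \<circ> a) ` stab (fst ` P)" if g: "g \<in> cyl P" for g
  proof (rule image_eqI)
    show "g = e \<circ> (inv_into UNIV e \<circ> g)" using e\<Gamma> by (auto simp: fun_eq_iff)
    have "inv_into UNIV e (g x) = x" if "(x, y) \<in> P" for x y
    proof -
      have "g x = e x" using g eP that by (auto simp: cyl_def)
      then show ?thesis using e\<Gamma> by simp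
    qed
    then show "inv_into UNIV e \<circ> g \<in> stab (fst ` P)"
      using g e\<Gamma> by (auto simp: stab_def cyl_def intro!: comp_in inv_in)
  qed
  moreover have "e \<circ> a \<in> cyl P" if a: "a \<in> stab (fst ` P)" for a
  proof -
    have "e (a x) = y" if "(x, y) \<in> P" for x y
    proof -
      have "a x = x" using a that by (force simp: stab_def)
      then show ?thesis using eP that by simp
    qed
    then show ?thesis using a e\<Gamma> by (auto simp: cyl_def stab_def intro!: comp_in)
  qed
  ultimately show ?thesis by auto
qed

text \<open>
  The stabiliser of \<open>F\<close> is the disjoint union of the cosets given by the possible images of \<open>y\<close>.
\<close>

lemma emeasure_stab_insert:
  assumes M: "left_invariant M" and F: "finite F" "x \<in> F"
  shows "emeasure M (stab F) = of_nat (card (orb F y)) * emeasure M (stab (insert y F))"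
proof -
  have sM: "sets M = sets (Borel_sigma topol)" using M by (simp add: left_invariant_def)
  define fib where "fib z = {g \<in> stab F. g y = z}" for z
  have fib: "fib z \<in> sets M \<and> emeasure M (fib z) = emeasure M (stab (insert y F))" if z: "z \<in> orb F y" for z
  proof -
    obtain e where e: "e \<in> stab F" "z = e y" using z unfolding orb_def by auto
    have fe: "fib z = (\<lambda>g. e \<circ> g) ` stab (insert y F)" unfolding fib_def e(2) by (rule stab_fibre[OF e(1)])
    have "fib z = cyl (insert (y, z) ((\<lambda>x. (x, x)) ` F))"
      unfolding fib_def stab_def cyl_def by auto
    then have "fib z \<in> sets M" using F by (auto intro!: open_in_sets[OF sM] openin_cyl)
    moreover have "emeasure M (fib z) = emeasure M (stab (insert y F))"
    proof -
      have "stab (insert y F) \<in> sets M" using F by (intro stab_in_sets[OF sM]) simp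
      moreover have "e \<in> \<Gamma>" using e(1) by (simp add: stab_def)
      ultimately show ?thesis using M unfolding fe left_invariant_def by blast
    qed
    ultimately show ?thesis by simp
  qed
  have "stab F = (\<Union>z\<in>orb F y. fib z)" unfolding fib_def orb_def by auto
  then have "emeasure M (stab F) = emeasure M (\<Union>z\<in>orb F y. fib z)" by simp
  also have "\<dots> = (\<Sum>z\<in>orb F y. emeasure M (fib z))"
    by (rule sum_emeasure[symmetric])
      (use fib finite_orb[OF F(2)] in \<open>auto simp: disjoint_family_on_def fib_def\<close>)
  also have "\<dots> = of_nat (card (orb F y)) * emeasure M (stab (insert y F))" using fib by simp
  finally show ?thesis .
qed

text \<open>
  The factor \<open>k\<close> is an index of stabilisers; it is the same for all left-invariant measures, which therefore are proportional on stabilisers.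
\<close>

lemma emeasure_stab_index:
  assumes "finite F"
  shows "\<exists>k>0. \<forall>M. left_invariant M \<longrightarrow> emeasure M (stab {x}) = of_nat k * emeasure M (stab (insert x F))"
  using assms
proof (induction F rule: finite_induct)
  case empty
  show ?case by (intro exI[of _ 1]) auto
next
  case (insert y F)
  then obtain k where k: "k > 0"
    "\<And>M. left_invariant M \<Longrightarrow> emeasure M (stab {x}) = of_nat k * emeasure M (stab (insert x F))" by auto
  have "emeasure M (stab {x}) = of_nat (k * card (orb (insert x F) y)) * emeasure M (stab (insert x (insert y F)))"
    if "left_invariant M" for M
    using k(2)[OF that] emeasure_stab_insert[OF that, of "insert x F" x y] insert.hyps
    by (simp add: insert_commute mult.assoc)
  moreover have "k * card (orb (insert x F) y) > 0" using k(1) card_orb_pos[of x "insert x F" y] by simp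
  ultimately show ?case by blast
qed

lemma emeasure_stab_eq:
  assumes M: "left_invariant M" and "h x y = 0"
  shows "emeasure M (stab {x}) = emeasure M (stab {y})"
proof -
  have "real (card (orb {y} x)) / real (card (orb {x} y)) = 1" using exp_h[of x y] assms(2) by simp
  then have "card (orb {x} y) = card (orb {y} x)" using card_orb_pos[of x "{x}" y] by simp
  then show ?thesis
    using emeasure_stab_insert[OF M, of "{x}" x y] emeasure_stab_insert[OF M, of "{y}" y x]
    by (simp add: insert_commute)
qed

text \<open>
  A left-invariant measure is determined by its value on one stabiliser. The cylinders that prescribe the image of \<open>v0\<close> are
  cosets of stabilisers or empty, form a generator that is stable under intersection, and countably many of finite measure cover the group.
\<close>

lemma left_invariant_eqI:
  assumes M: "left_invariant M" and N: "left_invariant N"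
    and eq: "emeasure M (stab {v0}) = emeasure N (stab {v0})"
    and fin: "emeasure M (stab {v0}) \<noteq> \<infinity>"
  shows "M = N"
proof -
  have sM: "sets M = sigma_sets \<Gamma> cyls" and sN: "sets N = sigma_sets \<Gamma> cyls"
    using M N sets_Borel by (auto simp: left_invariant_def)
  have coset: "emeasure M' (cyl P) = emeasure M' (stab (fst ` P))"
    if "left_invariant M'" "finite P" "e \<in> cyl P" for M' P e
  proof -
    have "stab (fst ` P) \<in> sets M'"
      using that by (intro stab_in_sets) (auto simp: left_invariant_def)
    moreover have "e \<in> \<Gamma>" using that by (simp add: cyl_def)
    ultimately show ?thesis unfolding cyl_eq_coset[OF that(3)] using that(1) by (simp add: left_invariant_def)
  qed
  have stab_eq: "emeasure M (stab (insert v0 F)) = emeasure N (stab (insert v0 F))" if F: "finite F" for F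
  proof -
    obtain k where k: "k > 0"
      "\<forall>M. left_invariant M \<longrightarrow> emeasure M (stab {v0}) = of_nat k * emeasure M (stab (insert v0 F))"
      using emeasure_stab_index[OF F, of v0] by blast
    show ?thesis
    proof (rule ennreal_of_nat_mult_cancel[OF _ k(1)])
      show "of_nat k * emeasure M (stab (insert v0 F)) = of_nat k * emeasure N (stab (insert v0 F))"
        unfolding k(2)[rule_format, OF M, symmetric] k(2)[rule_format, OF N, symmetric] by (rule eq)
    qed
  qed
  have cyl_eq: "emeasure M (cyl (insert (v0, y) P)) = emeasure N (cyl (insert (v0, y) P))" if "finite P" for P y
  proof (cases "cyl (insert (v0, y) P) = {}")
    case False
    then obtain e where "e \<in> cyl (insert (v0, y) P)" by auto
    then show ?thesis using coset[OF M, of "insert (v0, y) P" e] coset[OF N, of "insert (v0, y) P" e] that stab_eq[of "fst ` P"] by simp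
  qed simp
  let ?E = "cyl ` {P. finite P \<and> v0 \<in> fst ` P}"
  let ?A = "range (\<lambda>y. cyl {(v0, y)})"
  have gen: "sigma_sets \<Gamma> cyls = sigma_sets \<Gamma> ?E"
  proof (rule sigma_sets_eqI)
    fix C assume "C \<in> cyls"
    then obtain P where P: "finite P" "C = cyl P" unfolding cyls_def by auto
    have "C = (\<Union>y. cyl (insert (v0, y) P))" unfolding P(2) cyl_def by auto
    moreover have "(\<Union>y. cyl (insert (v0, y) P)) \<in> sets (sigma \<Gamma> ?E)"
    proof (rule sets.countable_UN'[OF countable_vertices])
      have "?E \<subseteq> Pow \<Gamma>" unfolding cyl_def by auto
      then show "(\<lambda>y. cyl (insert (v0, y) P)) ` UNIV \<subseteq> sets (sigma \<Gamma> ?E)" using P by auto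
    qed
    moreover have "?E \<subseteq> Pow \<Gamma>" unfolding cyl_def by auto
    ultimately show "C \<in> sigma_sets \<Gamma> ?E" by simp
  next
    fix C assume "C \<in> ?E"
    then show "C \<in> sigma_sets \<Gamma> cyls" unfolding cyls_def by auto
  qed
  show ?thesis
  proof (rule measure_eqI_generator_eq_countable[of ?E \<Gamma> M N ?A])
    have "cyl P \<inter> cyl Q = cyl (P \<union> Q)" for P Q unfolding cyl_def ball_Un by auto
    then show "Int_stable ?E" unfolding Int_stable_def by (auto intro!: image_eqI)
    show "?E \<subseteq> Pow \<Gamma>" unfolding cyl_def by auto
    show "sets M = sigma_sets \<Gamma> ?E" "sets N = sigma_sets \<Gamma> ?E" using sM sN gen by auto
    show "emeasure M X = emeasure N X" if X: "X \<in> ?E" for X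
    proof -
      obtain P y where P: "finite P" "X = cyl P" "(v0, y) \<in> P" using X by force
      then show ?thesis using cyl_eq[of P y] by (simp add: insert_absorb)
    qed
    show "?A \<subseteq> ?E" by auto
    show "\<Union> ?A = \<Gamma>" unfolding cyl_def by auto
    show "countable ?A" using countable_vertices by (rule countable_image)
    show "emeasure M a \<noteq> \<infinity>" if "a \<in> ?A" for a
    proof -
      obtain y where a: "a = cyl {(v0, y)}" using \<open>a \<in> ?A\<close> by auto
      then show ?thesis using coset[OF M, of "{(v0, y)}"] fin by (cases "a = {}") auto
    qed
  qed
qed

text \<open>
  Some compact set has finite positive measure, so by outer regularity some nonempty open set has finite measure. It contains a
  coset of the stabiliser of a finite set that contains \<open>v0\<close>, and this stabiliser has finite index in the stabiliser of \<open>v0\<close>.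
\<close>

lemma Haar_stab_finite:
  assumes R: "Radon_measure topol M" and nz: "emeasure M (space M) \<noteq> 0" and M: "left_invariant M"
  shows "emeasure M (stab {v0}) \<noteq> \<infinity>"
proof -
  have sM: "sets M = sets (Borel_sigma topol)" using M by (simp add: left_invariant_def)
  have sp: "space M = \<Gamma>" by (rule left_invariant_space[OF sM])
  have "emeasure M \<Gamma> = (SUP K\<in>{K. compactin topol K \<and> K \<subseteq> \<Gamma>}. emeasure M K)"
    using R openin_topspace[of topol] unfolding Radon_measure_def topspace_topol by blast
  then have "\<exists>K. compactin topol K \<and> emeasure M K \<noteq> 0"
    using nz unfolding sp by (metis (no_types, lifting) SUP_bot_conv(1) bot_ennreal mem_Collect_eq)
  then obtain K where K: "compactin topol K" "emeasure M K \<noteq> 0" by auto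
  have "K \<in> sets M" using K(2) emeasure_notin_sets by blast
  then have "(INF W\<in>{W. openin topol W \<and> K \<subseteq> W}. emeasure M W) < \<infinity>"
    using R K unfolding Radon_measure_def by auto
  then obtain W where W: "openin topol W" "K \<subseteq> W" "emeasure M W < \<infinity>" by (auto simp: INF_less_iff)
  have "K \<noteq> {}" using K(2) by auto
  then obtain g where "g \<in> W" using W by auto
  then obtain P where P: "finite P" "g \<in> cyl P" "cyl P \<subseteq> W" using cyl_subset_open[OF W(1)] by blast
  define Q where "Q = insert (v0, g v0) P"
  have Q: "finite Q" "g \<in> cyl Q" "cyl Q \<subseteq> W" using P unfolding Q_def cyl_def by auto
  have "emeasure M (stab (insert v0 (fst ` P))) = emeasure M (cyl Q)"
    using M Q(2) stab_in_sets[OF sM, of "insert v0 (fst ` P)"] P(1) cyl_eq_coset[OF Q(2)]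
    unfolding left_invariant_def Q_def by (simp add: cyl_def)
  also have "\<dots> \<le> emeasure M W" using Q W open_in_sets[OF sM] by (intro emeasure_mono) auto
  finally have fin: "emeasure M (stab (insert v0 (fst ` P))) < \<infinity>" using W(3) by (simp add: order.strict_trans1)
  obtain k where "\<forall>M. left_invariant M \<longrightarrow>
      emeasure M (stab {v0}) = of_nat k * emeasure M (stab (insert v0 (fst ` P)))"
    using emeasure_stab_index[OF finite_imageI[OF P(1)], of v0 fst] by blast
  then have "emeasure M (stab {v0}) = of_nat k * emeasure M (stab (insert v0 (fst ` P)))"
    using M by blast
  then show ?thesis using fin by (simp add: ennreal_mult_eq_top_iff)
qed

text \<open>
  If \<open>h\<close> vanishes, then all vertex stabilisers have the same measure. Translating a left Haar measure on the right by
  \<open>g\<close> produces a left-invariant measure which gives the stabiliser of \<open>v0\<close> the measure of the conjugate stabiliser of \<open>g\<inverse> v0\<close>;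
  so the translate is the original measure.
\<close>

theorem unimodular_if_h_zero:
  assumes h0: "\<And>x y. h x y = 0"
  shows "unimodular grp topol"
  unfolding unimodular_def
proof (intro allI impI)
  fix M assume Haar: "left_Haar_measure grp topol M"
  then have R: "Radon_measure topol M" and nz: "emeasure M (space M) \<noteq> 0"
    unfolding left_Haar_measure_def by auto
  have sM: "sets M = sets (Borel_sigma topol)" using R by (simp add: Radon_measure_def)
  have sp: "space M = \<Gamma>" by (rule left_invariant_space[OF sM])
  have lcos: "g <#\<^bsub>grp\<^esub> A = (\<lambda>a. g \<circ> a) ` A" and rcos: "A #>\<^bsub>grp\<^esub> g = (\<lambda>a. a \<circ> g) ` A" for g A
    unfolding l_coset_def r_coset_def Aut_def by auto
  have M: "left_invariant M"
    using Haar sM unfolding left_invariant_def left_Haar_measure_def lcos by auto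
  have right: "emeasure M ((\<lambda>a. a \<circ> g) ` A) = emeasure M A" if g: "g \<in> \<Gamma>" and A: "A \<in> sets M" for g A
  proof -
    \<comment> \<open>The image of \<open>M\<close> under \<open>r\<close> is the right translate: it maps \<open>B\<close> to the measure of \<open>B g\<close>.\<close>
    define r where "r a = a \<circ> inv_into UNIV g" for a :: "'v \<Rightarrow> 'v"
    have r: "r a \<in> \<Gamma>" if "a \<in> \<Gamma>" for a using that g unfolding r_def by (intro comp_in inv_in)
    have r_meas: "r \<in> measurable M M"
    proof (rule measurable_sigma_sets[of M \<Gamma> cyls])
      show "sets M = sigma_sets \<Gamma> cyls" using sM sets_Borel by simp
      show "cyls \<subseteq> Pow \<Gamma>" unfolding cyls_def cyl_def by auto
      show "r \<in> space M \<rightarrow> \<Gamma>" using r sp by auto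
      fix C assume "C \<in> cyls"
      then obtain P where P: "finite P" "C = cyl P" unfolding cyls_def by auto
      have "r -` C \<inter> space M = cyl ((\<lambda>(x, y). (inv_into UNIV g x, y)) ` P)"
        unfolding P(2) sp using r by (auto simp: cyl_def r_def)
      then show "r -` C \<inter> space M \<in> sets M" using P(1) by (auto intro!: open_in_sets[OF sM] openin_cyl)
    qed
    have pre: "r -` B \<inter> space M = (\<lambda>a. a \<circ> g) ` B" if "B \<subseteq> \<Gamma>" for B
    proof -
      have "a \<in> (\<lambda>a. a \<circ> g) ` B" if "r a \<in> B" for a
        using that g by (intro image_eqI[of _ _ "r a"]) (auto simp: r_def fun_eq_iff)
      moreover have "r (b \<circ> g) = b" for b using g by (auto simp: r_def fun_eq_iff)
      ultimately show ?thesis unfolding sp using that g by (auto intro: comp_in)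
    qed
    have em: "emeasure (distr M M r) B = emeasure M ((\<lambda>a. a \<circ> g) ` B)" if B: "B \<in> sets M" for B
      using emeasure_distr[OF r_meas B] pre[of B] sets.sets_into_space[OF B] sp by simp
    have N: "left_invariant (distr M M r)"
      unfolding left_invariant_def
    proof (intro conjI ballI)
      show "sets (distr M M r) = sets (Borel_sigma topol)" using sM by simp
      fix k B assume k: "k \<in> \<Gamma>" and "B \<in> sets (distr M M r)"
      then have B: "B \<in> sets M" by simp
      have kB: "(\<lambda>a. k \<circ> a) ` B \<in> sets M"
      proof -
        let ?l = "\<lambda>a. inv_into UNIV k \<circ> a"
        have "?l \<in> measurable M M"
        proof (rule measurable_sigma_sets[of M \<Gamma> cyls])
          show "sets M = sigma_sets \<Gamma> cyls" using sM sets_Borel by simp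
          show "cyls \<subseteq> Pow \<Gamma>" unfolding cyls_def cyl_def by auto
          show "?l \<in> space M \<rightarrow> \<Gamma>" unfolding sp using k by (auto intro: comp_in inv_in)
          fix C assume "C \<in> cyls"
          then obtain P where P: "finite P" "C = cyl P" unfolding cyls_def by auto
          have "inv_into UNIV k u = y \<longleftrightarrow> u = k y" for u y using k by (metis inv_apply apply_inv)
          then have "?l -` C \<inter> space M = cyl ((\<lambda>(x, y). (x, k y)) ` P)"
            unfolding P(2) sp using k by (auto simp: cyl_def intro: comp_in inv_in)
          then show "?l -` C \<inter> space M \<in> sets M" using P(1) by (auto intro!: open_in_sets[OF sM] openin_cyl)
        qed
        then have "?l -` B \<inter> space M \<in> sets M" using B by (rule measurable_sets)
        moreover have "?l -` B \<inter> space M = (\<lambda>a. k \<circ> a) ` B"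
        proof -
          have "a \<in> (\<lambda>a. k \<circ> a) ` B" if "?l a \<in> B" for a
            using that k by (intro image_eqI[of _ _ "?l a"]) (auto simp: fun_eq_iff)
          moreover have "?l (k \<circ> b) = b" for b using k by (auto simp: fun_eq_iff)
          ultimately show ?thesis using sets.sets_into_space[OF B] k unfolding sp by (auto intro: comp_in)
        qed
        ultimately show ?thesis by simp
      qed
      have Bg: "(\<lambda>a. a \<circ> g) ` B \<in> sets M"
        using measurable_sets[OF r_meas B] pre[of B] sets.sets_into_space[OF B] sp by simp
      have "emeasure M ((\<lambda>a. a \<circ> g) ` (\<lambda>a. k \<circ> a) ` B) = emeasure M ((\<lambda>a. k \<circ> a) ` (\<lambda>a. a \<circ> g) ` B)"
        by (simp add: image_image comp_assoc)
      then show "emeasure (distr M M r) ((\<lambda>a. k \<circ> a) ` B) = emeasure (distr M M r) B"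
        unfolding em[OF kB] em[OF B] using M Bg k by (simp add: left_invariant_def)
    qed
    have same: "emeasure (distr M M r) (stab {v0}) = emeasure M (stab {v0})"
    proof -
      have st: "stab {v0} \<in> sets M" by (rule stab_in_sets[OF sM]) simp
      have "(\<lambda>a. a \<circ> g) ` stab {v0} = cyl {(inv_into UNIV g v0, v0)}"
        using pre[of "stab {v0}", symmetric] r sp by (auto simp: stab_def cyl_def r_def)
      also have "\<dots> = (\<lambda>a. g \<circ> a) ` stab {inv_into UNIV g v0}"
        using cyl_eq_coset[of g "{(inv_into UNIV g v0, v0)}"] g by (simp add: cyl_def)
      finally have "emeasure (distr M M r) (stab {v0}) = emeasure M ((\<lambda>a. g \<circ> a) ` stab {inv_into UNIV g v0})"
        using em[OF st] by simp
      also have "\<dots> = emeasure M (stab {inv_into UNIV g v0})"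
        using M g stab_in_sets[OF sM, of "{inv_into UNIV g v0}"] by (simp add: left_invariant_def)
      also have "\<dots> = emeasure M (stab {v0})" by (rule emeasure_stab_eq[OF M h0])
      finally show ?thesis .
    qed
    have "M = distr M M r"
      by (rule left_invariant_eqI[OF M N same[symmetric] Haar_stab_finite[OF R nz M]])
    then show ?thesis using em[OF A] by simp
  qed
  show "right_Haar_measure grp topol M"
    unfolding right_Haar_measure_def rcos using R nz right by auto
qed

end

context transitive_automorphisms
begin

text \<open>
  A function on the vertices is pulled back to the group along the orbit map \<open>g \<mapsto> g v0\<close>, which is locally constant and so measurable.
\<close>

lemma amenable_imp_vertex_mean:
  assumes "amenable grp topol"
  shows "\<exists>m. vertex_mean \<Gamma> m"
proof -
  obtain M \<mu> where M: "left_Haar_measure grp topol M" and \<mu>: "invariant_mean grp M \<mu>"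
    using assms unfolding amenable_def by auto
  have sM: "sets M = sets (Borel_sigma topol)"
    using M unfolding left_Haar_measure_def Radon_measure_def by simp
  have sp: "space M = \<Gamma>" by (rule left_invariant_space[OF sM])
  define ev :: "('v \<Rightarrow> real) \<Rightarrow> ('v \<Rightarrow> 'v) \<Rightarrow> real" where "ev f = (\<lambda>g. f (g v0))" for f
  have ev: "ev f \<in> L_infinity M" if f: "bdd f" for f
  proof -
    have "ev f \<in> borel_measurable M"
    proof (rule measurableI)
      fix B :: "real set"
      have "ev f -` B \<inter> space M = {g \<in> \<Gamma>. g v0 \<in> f -` B}" unfolding ev_def sp by auto
      then show "ev f -` B \<inter> space M \<in> sets M"
        using open_in_sets[OF sM openin_evaluation[of v0 "f -` B"]] by (simp only:)
    qed simp
    moreover obtain C where "\<And>x. \<bar>f x\<bar> \<le> C" using f unfolding bdd_def by blast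
    ultimately show ?thesis unfolding L_infinity_def ev_def by (auto intro!: exI[of _ C])
  qed
  have carrier: "carrier grp = \<Gamma>" and mult: "x \<otimes>\<^bsub>grp\<^esub> y = x \<circ> y" for x y
    unfolding Aut_def by simp_all
  have "vertex_mean \<Gamma> (\<lambda>f. \<mu> (ev f))"
    unfolding vertex_mean_def
  proof (intro conjI allI impI ballI)
    fix f g :: "'v \<Rightarrow> real" assume "bdd f" "bdd g"
    then have "\<mu> (\<lambda>x. ev f x + ev g x) = \<mu> (ev f) + \<mu> (ev g)"
      using \<mu> ev unfolding invariant_mean_def by simp
    then show "\<mu> (ev (\<lambda>x. f x + g x)) = \<mu> (ev f) + \<mu> (ev g)" by (simp add: ev_def)
  next
    fix c and f :: "'v \<Rightarrow> real" assume "bdd f"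
    then have "\<mu> (\<lambda>x. c * ev f x) = c * \<mu> (ev f)"
      using \<mu> ev unfolding invariant_mean_def by simp
    then show "\<mu> (ev (\<lambda>x. c * f x)) = c * \<mu> (ev f)" by (simp add: ev_def)
  next
    show "\<mu> (ev (\<lambda>_. 1)) = 1" using \<mu> unfolding invariant_mean_def ev_def by simp
  next
    fix f :: "'v \<Rightarrow> real" assume "bdd f" "\<forall>x. 0 \<le> f x"
    then show "0 \<le> \<mu> (ev f)"
      using \<mu> ev[of f] unfolding invariant_mean_def by (simp add: ev_def)
  next
    fix \<gamma> and f :: "'v \<Rightarrow> real" assume "\<gamma> \<in> \<Gamma>" "bdd f"
    then have "\<mu> (\<lambda>x. ev f (\<gamma> \<otimes>\<^bsub>grp\<^esub> x)) = \<mu> (ev f)"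
      using \<mu> ev[of f] unfolding invariant_mean_def carrier by blast
    then show "\<mu> (ev (\<lambda>x. f (\<gamma> x))) = \<mu> (ev f)" unfolding mult by (simp add: ev_def)
  qed
  then show ?thesis by blast
qed

end

section \<open>The decay of return probabilities\<close>

lemma group_Aut: "group (Aut E)"
proof (rule groupI)
  fix g assume "g \<in> carrier (Aut E)"
  then have g: "bij g" "\<And>x y. (g x, g y) \<in> E \<longleftrightarrow> (x, y) \<in> E" by (auto simp: Aut_def automorphisms_def)
  have "(inv_into UNIV g x, inv_into UNIV g y) \<in> E \<longleftrightarrow> (x, y) \<in> E" for x y
    using g(2)[of "inv_into UNIV g x" "inv_into UNIV g y"] g(1) by (simp add: bij_is_surj surj_f_inv_f)
  then have "inv_into UNIV g \<in> carrier (Aut E)"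
    using g(1) by (simp add: Aut_def automorphisms_def bij_imp_bij_inv)
  moreover have "inv_into UNIV g \<circ> g = id" using g(1) by (simp add: bij_is_inj)
  ultimately show "\<exists>k\<in>carrier (Aut E). k \<otimes>\<^bsub>Aut E\<^esub> g = \<one>\<^bsub>Aut E\<^esub>" by (auto simp: Aut_def)
qed (auto simp: Aut_def automorphisms_def bij_comp comp_assoc)

lemma inv_Aut: "g \<in> automorphisms E \<Longrightarrow> m_inv (Aut E) g = inv_into UNIV g"
proof -
  assume g: "g \<in> automorphisms E"
  interpret group "Aut E" by (rule group_Aut)
  have "m_inv (Aut E) g \<circ> g = id" using l_inv[of g] g by (simp add: Aut_def)
  moreover have "g \<circ> inv_into UNIV g = id" using g by (simp add: automorphisms_def bij_is_surj surj_iff[symmetric])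
  ultimately show ?thesis by (metis comp_assoc comp_id id_comp)
qed

theorem theorem1p2:
  fixes E :: "'v rel" and \<Gamma> :: "('v \<Rightarrow> 'v) set"
  assumes "infinite (UNIV :: 'v set)"
    and "simple_graph E"
    and "locally_finite_graph E"
    and "connected_graph E"
    and "subgroup \<Gamma> (Aut E)"
    and "closedin (Aut_topology E) \<Gamma>"
    and "transitive_action \<Gamma>"
    and "amenable ((Aut E)\<lparr>carrier := \<Gamma>\<rparr>) (subtopology (Aut_topology E) \<Gamma>)"
    and "\<not> unimodular ((Aut E)\<lparr>carrier := \<Gamma>\<rparr>) (subtopology (Aut_topology E) \<Gamma>)"
  shows "\<exists>c>0. \<forall>x. \<forall>n\<ge>1.
    return_prob E x n / spectral_radius E x ^ n \<le> c * real n powr (- 3 / 2)"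
proof -
  have sub: "\<Gamma> \<subseteq> automorphisms E" using subgroup.subset[OF assms(5)] by (simp add: Aut_def)
  fix v0 :: 'v
  interpret transitive_automorphisms E \<Gamma> v0
  proof
    show "sym E" using assms(2) by (simp add: simple_graph_def)
    show "finite (E `` {x})" for x using assms(3) by (simp add: locally_finite_graph_def)
    show "(x, y) \<in> E\<^sup>*" for x y using assms(4) by (simp add: connected_graph_def)
    show "id \<in> \<Gamma>" using subgroup.one_closed[OF assms(5)] by (simp add: Aut_def)
    show "g \<circ> k \<in> \<Gamma>" if "g \<in> \<Gamma>" "k \<in> \<Gamma>" for g k
      using subgroup.m_closed[OF assms(5) that] by (simp add: Aut_def)
    show "inv_into UNIV g \<in> \<Gamma>" if "g \<in> \<Gamma>" for g
      using subgroup.m_inv_closed[OF assms(5) that] inv_Aut[of g E] sub that by auto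
    show "bij g" if "g \<in> \<Gamma>" for g using sub that by (auto simp: automorphisms_def)
    show "(g x, g y) \<in> E \<longleftrightarrow> (x, y) \<in> E" if "g \<in> \<Gamma>" for g x y
      using sub that by (auto simp: automorphisms_def)
    show "\<exists>g\<in>\<Gamma>. g x = y" for x y using assms(7) by (auto simp: transitive_action_def)
    show "\<Gamma> \<subseteq> automorphisms E" by (rule sub)
  qed
  interpret nonunimodular_graph E \<Gamma> v0
  proof
    show "E `` {v0} \<noteq> {}"
    proof
      assume none: "E `` {v0} = {}"
      have "y = v0" for y
        using connected[of v0 y] none by (auto elim: converse_rtranclE)
      then have "(UNIV :: 'v set) = {v0}" by auto
      then show False using assms(1) by (metis finite.emptyI finite.insertI)
    qed
    show "\<exists>x y. h x y \<noteq> 0" using unimodular_if_h_zero assms(9) by blast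
  qed
  obtain C where C: "C > 0" "\<And>n. confined UNIV n v0 v0 \<le> C * (real n + 1) powr (- 3 / 2)"
    by (rule weighted_loops_bound) blast
  obtain m where "vertex_mean \<Gamma> m" using amenable_imp_vertex_mean[OF assms(8)] by blast
  then have lam: "lam \<le> spectral_radius E v0" by (rule lam_le_spectral_radius)
  show ?thesis
  proof (intro exI conjI allI impI)
    show "C > 0" by (rule C(1))
    fix x and n :: nat assume n: "1 \<le> n"
    have radius: "spectral_radius E x = spectral_radius E v0"
      unfolding spectral_radius_def return_prob_eq[of x] ..
    have "return_prob E x n / spectral_radius E x ^ n = confined UNIV n v0 v0 * lam ^ n / spectral_radius E v0 ^ n"
      unfolding radius return_prob_eq[of x] return_prob_eq_confined ..
    also have "\<dots> \<le> confined UNIV n v0 v0 * lam ^ n / lam ^ n"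
      using lam lam_pos confined_nonneg by (intro divide_left_mono power_mono mult_nonneg_nonneg mult_pos_pos zero_less_power) auto
    also have "\<dots> = confined UNIV n v0 v0" using lam_pos by simp
    also have "\<dots> \<le> C * (real n + 1) powr (- 3 / 2)" by (rule C(2))
    also have "\<dots> \<le> C * real n powr (- 3 / 2)"
      using C(1) n by (intro mult_left_mono powr_mono2') auto
    finally show "return_prob E x n / spectral_radius E x ^ n \<le> C * real n powr (- 3 / 2)" .
  qed
qed

end
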